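(* Let $T$ be the symmetric tridiagonal operator determined by sequences $a_n>0$, $b_n\in\mathbb{R}$ ($n\ge 1$), and let $m\in\mathbb{N}$, $m\ge1$. If there exists an index $n_0\in\mathbb{N}$ such that $$\widetilde{G}_{m,n}<\frac{1}{2^m}\quad\text{for all } n\ge n_0,\qquad \widetilde{G}_{m,n}=\sum_{(\boldsymbol{j}_{m+1}|\boldsymbol{k}_m)\in\widehat{\mathcal{I}}_m}\frac{a_{n+j_{m+1}-k_1}^2}{b_{n+j_{m+1}-j_1}^2}\cdots\frac{a_{n+j_{m+1}-k_m}^2}{b_{n+j_{m+1}-j_m}^2},$$ then $T$ is self-adjoint.
   Context: $(H,(\cdot,\cdot))$ is an infinite-dimensional complex Hilbert space with orthonormal basis $\{e_n\}_{n=1}^\infty$. Given real sequences $a_n>0$, $b_n\in\mathbb{R}$ ($n\ge1$), the formula $Te_n=a_ne_{n+1}+b_ne_n+a_{n-1}e_{n-1}$ (with $e_0=0$) defines a symmetric operator on the linear span of $\{e_n\}_{n=1}^\infty$; $T$ denotes the closure of this operator. Multi-indices: $\widehat{\mathcal{I}}_m$ is the set of pairs $(\boldsymbol{j}_{m+1}|\boldsymbol{k}_m)$ with $\boldsymbol{j}_{m+1}=(j_1,\dots,j_{m+1})\in\mathbb{Z}^{m+1}$, $\boldsymbol{k}_m=(k_1,\dots,k_m)\in\mathbb{Z}^m$ such that $j_1=0$ and for each $s=1,\dots,m$ either $k_s=j_s=j_{s+1}+1$ or $k_s=j_s+1=j_{s+1}$ (negative values are allowed). For example $\widetilde{G}_{1,n}=\frac{a_n^2}{b_{n+1}^2}+\frac{a_{n-1}^2}{b_{n-1}^2}$.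 Conventions: a quotient with denominator $b_k^2=0$, $k\ge1$, is $+\infty$ (so the inequality then fails); summands involving a nonpositive index of $a$ or $b$ are taken to be $0$ (this concerns only finitely many $n$, and one may always take $n_0>m$). *)

theory Defs
  imports "HOL-Analysis.Analysis"
begin

text \<open>
  Complex Hilbert spaces. Every complex Hilbert space is a complete real inner product space for
  the real part of its inner product, so norm and topology are those of \<^class>\<open>real_inner\<close>.
  The complex inner product is linear in its first argument.
\<close>

class complex_hilbert = real_inner + complete_space +
  fixes scaleC :: "complex \<Rightarrow> 'a \<Rightarrow> 'a" (infixr "*\<^sub>C" 75)
    and cinner :: "'a \<Rightarrow> 'a \<Rightarrow> complex"
  assumes scaleC_add_right: "c *\<^sub>C (x + y) = c *\<^sub>C x + c *\<^sub>C y"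
    and scaleC_add_left: "(c + d) *\<^sub>C x = c *\<^sub>C x + d *\<^sub>C x"
    and scaleC_scaleC: "c *\<^sub>C (d *\<^sub>C x) = (c * d) *\<^sub>C x"
    and scaleC_of_real: "complex_of_real r *\<^sub>C x = r *\<^sub>R x"
    and cinner_commute: "cinner x y = cnj (cinner y x)"
    and cinner_add_left: "cinner (x + y) z = cinner x z + cinner y z"
    and cinner_scaleC_left: "cinner (c *\<^sub>C x) y = c * cinner x y"
    and inner_eq_Re_cinner: "inner x y = Re (cinner x y)"

lemma scaleC_one: "1 *\<^sub>C x = (x :: 'a :: complex_hilbert)"
  using scaleC_of_real[of 1 x] by simp

global_interpretation complex_vector:
  vector_space "scaleC :: complex \<Rightarrow> 'a \<Rightarrow> 'a :: complex_hilbert"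
  defines cspan = complex_vector.span
  by unfold_locales (simp_all add: scaleC_add_right scaleC_add_left scaleC_scaleC scaleC_one)

text \<open>An orthonormal basis indexed by $n \ge 1$; the vector \<open>e 0\<close> is irrelevant.\<close>

definition orthonormal_basis :: "(nat \<Rightarrow> 'a :: complex_hilbert) \<Rightarrow> bool" where
  "orthonormal_basis e \<longleftrightarrow>
     (\<forall>m\<ge>1. \<forall>n\<ge>1. cinner (e m) (e n) = (if m = n then 1 else 0)) \<and>
     closure (cspan (e ` {1..})) = UNIV"

text \<open>Unbounded operators are identified with their graphs, so the closure of an operator is the
  topological closure of its graph.\<close>

definition linear_operator :: "('a :: complex_hilbert \<times> 'a) set \<Rightarrow> bool" where
  "linear_operator T \<longleftrightarrow>
     single_valued T \<and> (0, 0) \<in> T \<and>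
     (\<forall>x y x' y'. (x, y) \<in> T \<longrightarrow> (x', y') \<in> T \<longrightarrow> (x + x', y + y') \<in> T) \<and>
     (\<forall>c x y. (x, y) \<in> T \<longrightarrow> (c *\<^sub>C x, c *\<^sub>C y) \<in> T)"

definition adjoint_operator ::
    "('a :: complex_hilbert \<times> 'a) set \<Rightarrow> ('a \<times> 'a) set" where
  "adjoint_operator T = {(y, z). \<forall>(x, w) \<in> T. cinner w y = cinner x z}"

definition self_adjoint :: "('a :: complex_hilbert \<times> 'a) set \<Rightarrow> bool" where
  "self_adjoint T \<longleftrightarrow>
     linear_operator T \<and> closure (Domain T) = UNIV \<and> adjoint_operator T = T"

text \<open>The image of \<open>e n\<close> for $n \ge 1$.\<close>

definition tridiagonal_image ::
    "(nat \<Rightarrow> real) \<Rightarrow> (nat \<Rightarrow> real) \<Rightarrow> (nat \<Rightarrow> 'a :: complex_hilbert) \<Rightarrow> nat \<Rightarrow> 'a" where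
  "tridiagonal_image a b e n =
     a n *\<^sub>R e (n + 1) + b n *\<^sub>R e n + (if n = 1 then 0 else a (n - 1) *\<^sub>R e (n - 1))"

text \<open>The operator on the linear span of $\{e_n\}_{n \ge 1}$, and its closure.\<close>

definition tridiagonal_operator0 ::
    "(nat \<Rightarrow> real) \<Rightarrow> (nat \<Rightarrow> real) \<Rightarrow> (nat \<Rightarrow> 'a :: complex_hilbert) \<Rightarrow> ('a \<times> 'a) set" where
  "tridiagonal_operator0 a b e =
     {(\<Sum>n=1..N. c n *\<^sub>C e n, \<Sum>n=1..N. c n *\<^sub>C tridiagonal_image a b e n) |
       (c :: nat \<Rightarrow> complex) (N :: nat). True}"

definition tridiagonal_operator ::
    "(nat \<Rightarrow> real) \<Rightarrow> (nat \<Rightarrow> real) \<Rightarrow> (nat \<Rightarrow> 'a :: complex_hilbert) \<Rightarrow> ('a \<times> 'a) set" where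
  "tridiagonal_operator a b e = closure (tridiagonal_operator0 a b e)"

text \<open>Lists are indexed from 0: \<open>j ! s\<close> and \<open>k ! s\<close> stand for $j_{s+1}$ and $k_{s+1}$;
  in particular \<open>j ! m\<close> is $j_{m+1}$.\<close>

definition multi_indices :: "nat \<Rightarrow> (int list \<times> int list) set" where
  "multi_indices m =
     {(j, k). length j = m + 1 \<and> length k = m \<and> j ! 0 = 0 \<and>
       (\<forall>s<m. (k ! s = j ! s \<and> j ! s = j ! (s + 1) + 1) \<or>
              (k ! s = j ! s + 1 \<and> j ! s + 1 = j ! (s + 1)))}"

lemma finite_multi_indices: "finite (multi_indices m)"
proof -
  let ?A = "{- int m - 1..int m + 1}"
  let ?L = "\<lambda>l. {xs. set xs \<subseteq> ?A \<and> length xs = l}"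
  have "j \<in> ?L (m + 1) \<and> k \<in> ?L m" if "(j, k) \<in> multi_indices m" for j k
  proof -
    have len: "length j = m + 1" "length k = m" and j0: "j ! 0 = 0"
      and step: "\<And>s. s < m \<Longrightarrow> (k ! s = j ! s \<and> j ! s = j ! (s + 1) + 1) \<or>
              (k ! s = j ! s + 1 \<and> j ! s + 1 = j ! (s + 1))"
      using that by (auto simp: multi_indices_def)
    have bd: "\<bar>j ! s\<bar> \<le> int s" if "s \<le> m" for s
      using that
    proof (induction s)
      case 0
      then show ?case using j0 by simp
    next
      case (Suc s)
      then show ?case using step[of s] by auto
    qed
    have "j ! s \<in> ?A" if "s < m + 1" for s
      using bd[of s] that by auto
    moreover have "k ! s \<in> ?A" if "s < m" for s
      using bd[of s] step[OF that] that by auto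
    ultimately show ?thesis
      using len by (auto simp: set_conv_nth simp del: atLeastAtMost_iff)
  qed
  then have "multi_indices m \<subseteq> ?L (m + 1) \<times> ?L m"
    by auto
  then show ?thesis
    by (rule finite_subset) (intro finite_cartesian_product finite_lists_length_eq, auto)
qed

text \<open>
  The values are in \<^typ>\<open>ennreal\<close>, where a nonzero number divided by 0 is \<open>\<infinity>\<close>. Summands in
  which a nonpositive index occurs are 0.
\<close>

definition G_summand ::
    "(nat \<Rightarrow> real) \<Rightarrow> (nat \<Rightarrow> real) \<Rightarrow> nat \<Rightarrow> nat \<Rightarrow> int list \<Rightarrow> int list \<Rightarrow> ennreal" where
  "G_summand a b m n j k =
     (if \<forall>s<m. int n + j ! m - k ! s \<ge> 1 \<and> int n + j ! m - j ! s \<ge> 1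
      then \<Prod>s<m. ennreal ((a (nat (int n + j ! m - k ! s)))\<^sup>2) /
                  ennreal ((b (nat (int n + j ! m - j ! s)))\<^sup>2)
      else 0)"

definition G_tilde :: "(nat \<Rightarrow> real) \<Rightarrow> (nat \<Rightarrow> real) \<Rightarrow> nat \<Rightarrow> nat \<Rightarrow> ennreal" where
  "G_tilde a b m n = (\<Sum>(j, k) \<in> multi_indices m. G_summand a b m n j k)"

lemma G_tilde_1:
  assumes "n \<ge> 2"
  shows "G_tilde a b 1 n =
    ennreal ((a n)\<^sup>2) / ennreal ((b (n + 1))\<^sup>2) +
    ennreal ((a (n - 1))\<^sup>2) / ennreal ((b (n - 1))\<^sup>2)"
proof -
  have "multi_indices 1 = {([0, 1], [1]), ([0, -1], [0])}"
    by (auto simp: multi_indices_def length_Suc_conv)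
  moreover have "nat (int n - 1) = n - 1" "nat (int n + 1) = n + 1"
    by auto
  ultimately show ?thesis
    using assms by (simp add: G_tilde_def G_summand_def)
qed

end

theory Submission
  imports Defs
begin

text \<open>
  Let \<open>u\<close> be the solution of $a_n u_{n+1} + b_n u_n + a_{n-1} u_{n-1} = 0$ for $n > M$ with
  $u_M = 0$, $u_{M+1} = 1$. Split the tail of the matrix into its diagonal part $D$ and its
  off-diagonal part $J$ and put $K = J D^{-1}$. By Cauchy--Schwarz over the $2^m$ walks of length
  $m$ from $n$, $|(K^m x)_n|^2$ is at most $\widetilde{G}_{m,n}$ times the sum of $|x|^2$ over the
  end points, so $\|K^m x\|^2 \le \|x\|^2 - |x_{M+1}|^2/2$, the gain coming from the walks that
  leave the half-line. As $u = (-1)^m (K^T)^m u$, testing against truncations of \<open>u\<close> shows that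
  \<open>u\<close> is not square summable.

  If the adjoint of the operator on the span were not symmetric, two vectors in its domain would
  have a Wronskian with nonzero limit, and writing \<open>u\<close> in terms of them (Gronwall for the
  coefficients) would make \<open>u\<close> square summable. So the adjoint is symmetric, and hence equal to
  the closure.
\<close>

section \<open>Walks on a half-line\<close>

text \<open>Sequences live on $n \ge 1$; a walk that reaches 0 is killed there.\<close>

definition nbr :: "(nat \<Rightarrow> real) \<Rightarrow> (nat \<Rightarrow> real) \<Rightarrow> (nat \<Rightarrow> real) \<Rightarrow> nat \<Rightarrow> real" where
  "nbr c d f n = (if n = 0 then 0 else c n * f (n + 1) + d n * f (n - 1))"

text \<open>With unit weights and \<open>f 0 = 0\<close>, the \<open>m\<close>-th iterate at
  \<open>n\<close> adds up \<open>f\<close> over the end points of all \<open>m\<close>-step walks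
  from \<open>n\<close> that avoid 0.\<close>

abbreviation nbr_sum :: "(nat \<Rightarrow> real) \<Rightarrow> nat \<Rightarrow> real" where
  "nbr_sum \<equiv> nbr (\<lambda>_. 1) (\<lambda>_. 1)"

lemma nbr_0 [simp]: "nbr c d f 0 = 0"
  by (simp add: nbr_def)

lemma nbr_pos: "n > 0 \<Longrightarrow> nbr c d f n = c n * f (n + 1) + d n * f (n - 1)"
  by (simp add: nbr_def)

lemma nbr_power_0 [simp]: "f 0 = 0 \<Longrightarrow> (nbr c d ^^ m) f 0 = 0"
  by (induction m) auto

lemma nbr_support: "(\<And>n. n > N \<Longrightarrow> f n = 0) \<Longrightarrow> n > Suc N \<Longrightarrow> nbr c d f n = 0"
  by (simp add: nbr_def)

lemma nbr_power_nonneg: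
  assumes "\<And>n. c n \<ge> 0" "\<And>n. d n \<ge> 0" "\<And>n. f n \<ge> 0"
  shows "(nbr c d ^^ m) f n \<ge> 0"
proof (induction m arbitrary: n)
  case 0
  then show ?case using assms(3) by simp
next
  case (Suc m)
  then show ?case using assms by (cases "n = 0") (simp_all add: nbr_pos)
qed

text \<open>The matrix \<open>nbr c d\<close> has entries \<open>c n\<close> just above and
  \<open>d n\<close> just below the diagonal; its transpose has the same shape, with the weights
  exchanged and shifted by one. One application widens the support of \<open>x\<close> by one, hence
  \<open>Suc N\<close>.\<close>

lemma nbr_adjoint:
  assumes "x 0 = 0" "y 0 = 0" "\<And>n. n > N \<Longrightarrow> x n = 0"
  shows "(\<Sum>n\<le>Suc N. nbr c d x n * y n) =
    (\<Sum>n\<le>N. x n * nbr (\<lambda>n. d (n + 1)) (\<lambda>n. c (n - 1)) y n)"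
proof -
  have "(\<Sum>n\<le>Suc N. nbr c d x n * y n) =
      (\<Sum>n\<le>N. c (n + 1) * x (n + 2) * y (n + 1)) + (\<Sum>n\<le>N. d (n + 1) * x n * y (n + 1))"
    by (subst sum.atMost_Suc_shift) (simp add: nbr_def algebra_simps sum.distrib)
  \<comment> \<open>This sum is shifted by one index twice; the terms gained or lost at the ends
    vanish because \<open>y 0 = 0\<close>, \<open>x 0 = 0\<close> and \<open>x\<close> is 0 beyond
    \<open>N\<close>.\<close>
  also have "(\<Sum>n\<le>N. c (n + 1) * x (n + 2) * y (n + 1)) = (\<Sum>n\<le>Suc N. c n * x (n + 1) * y n)"
    by (subst sum.atMost_Suc_shift) (simp add: assms)
  also have "\<dots> = (\<Sum>n\<le>N. c n * x (n + 1) * y n)"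
    using assms(3) by simp
  also have "\<dots> = (\<Sum>n\<le>Suc N. c (n - 1) * x n * y (n - 1))"
    by (subst sum.atMost_Suc_shift) (simp add: assms)
  also have "\<dots> = (\<Sum>n\<le>N. c (n - 1) * x n * y (n - 1))"
    using assms(3) by simp
  finally have "(\<Sum>n\<le>Suc N. nbr c d x n * y n) =
      (\<Sum>n\<le>N. c (n - 1) * x n * y (n - 1) + d (n + 1) * x n * y (n + 1))"
    by (simp add: sum.distrib)
  also have "\<dots> = (\<Sum>n\<le>N. x n * nbr (\<lambda>n. d (n + 1)) (\<lambda>n. c (n - 1)) y n)"
    by (rule sum.cong) (auto simp: nbr_def assms algebra_simps)
  finally show ?thesis .
qed

text \<open>The recursion says that \<open>u\<close> is an eigenvector of the transposed matrix for
  the eigenvalue -1, so each factor moved across the pairing contributes a sign. The support of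
  \<open>x\<close> keeps every pairing a finite sum even if \<open>u\<close> grows.\<close>

lemma nbr_power_eigen:
  assumes u: "u 0 = 0" "\<And>n. n \<ge> 1 \<Longrightarrow> d (n + 1) * u (n + 1) + c (n - 1) * u (n - 1) = - u n"
    and x: "x 0 = 0" "\<And>n. n > N \<Longrightarrow> x n = 0"
  shows "(\<Sum>n\<le>N + m. (nbr c d ^^ m) x n * u n) = (-1) ^ m * (\<Sum>n\<le>N. x n * u n)"
  using x
proof (induction m arbitrary: x N)
  case (Suc m)
  have "(\<Sum>n\<le>N + Suc m. (nbr c d ^^ Suc m) x n * u n) =
      (\<Sum>n\<le>Suc N + m. (nbr c d ^^ m) (nbr c d x) n * u n)"
    by (simp add: funpow_swap1)
  also have "\<dots> = (-1) ^ m * (\<Sum>n\<le>Suc N. nbr c d x n * u n)"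
    using Suc.prems by (intro Suc.IH) (auto intro: nbr_support)
  also have "(\<Sum>n\<le>Suc N. nbr c d x n * u n) =
      (\<Sum>n\<le>N. x n * nbr (\<lambda>n. d (n + 1)) (\<lambda>n. c (n - 1)) u n)"
    using Suc.prems u(1) by (intro nbr_adjoint)
  also have "\<dots> = (\<Sum>n\<le>N. - (x n * u n))"
    using u(2) by (intro sum.cong) (auto simp: nbr_def Suc.prems(1))
  finally show ?case
    by (simp add: sum_negf)
qed simp

text \<open>Every value is collected by both of its neighbours, except that \<open>f 1\<close> is
  not collected at 0, where the walk is killed. This missing term is the source of the strict gain
  below.\<close>

lemma sum_nbr_sum:
  assumes "f 0 = 0" "\<And>n. n > N \<Longrightarrow> f n = 0"
  shows "(\<Sum>n\<le>Suc N. nbr_sum f n) = 2 * (\<Sum>n\<le>N. f n) - f 1"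
proof -
  have "(\<Sum>n\<le>N. f n) = (\<Sum>n\<le>Suc (Suc N). f n)"
    using assms(2) by simp
  also have "\<dots> = f 1 + (\<Sum>n\<le>N. f (n + 2))"
    unfolding sum.atMost_Suc_shift by (simp add: assms(1))
  finally have "(\<Sum>n\<le>N. f n) = f 1 + (\<Sum>n\<le>N. f (n + 2))" .
  moreover have "(\<Sum>n\<le>Suc N. nbr_sum f n) = (\<Sum>n\<le>N. f (n + 2)) + (\<Sum>n\<le>N. f n)"
    unfolding sum.atMost_Suc_shift by (simp add: nbr_def sum.distrib)
  ultimately show ?thesis
    by simp
qed

lemma sum_nbr_sum_power_le:
  assumes "f 0 = 0" "\<And>n. n > N \<Longrightarrow> f n = 0" "\<And>n. f n \<ge> 0"
  shows "(\<Sum>n\<le>N + m. (nbr_sum ^^ m) f n) \<le> 2 ^ m * (\<Sum>n\<le>N. f n)"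
  using assms
proof (induction m arbitrary: f N)
  case (Suc m)
  have "(\<Sum>n\<le>N + Suc m. (nbr_sum ^^ Suc m) f n) = (\<Sum>n\<le>Suc N + m. (nbr_sum ^^ m) (nbr_sum f) n)"
    by (simp add: funpow_swap1)
  also have "\<dots> \<le> 2 ^ m * (\<Sum>n\<le>Suc N. nbr_sum f n)"
    using Suc.prems nbr_power_nonneg[of "\<lambda>_. 1" "\<lambda>_. 1" f 1]
    by (intro Suc.IH) (auto intro: nbr_support)
  also have "\<dots> \<le> 2 ^ m * (2 * (\<Sum>n\<le>N. f n))"
    using sum_nbr_sum[of f N] Suc.prems by (intro mult_left_mono) auto
  finally show ?case
    by simp
qed simp

text \<open>The boundary loss \<open>f 1\<close> is kept for the application next to
  \<open>f\<close> only; each of the remaining \<open>k\<close> applications at most doubles the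
  sum.\<close>

lemma sum_nbr_sum_power_le_strict:
  assumes "f 0 = 0" "\<And>n. n > N \<Longrightarrow> f n = 0" "\<And>n. f n \<ge> 0" "m \<ge> 1"
  shows "(\<Sum>n\<le>N + m. (nbr_sum ^^ m) f n) \<le> 2 ^ m * ((\<Sum>n\<le>N. f n) - f 1 / 2)"
proof -
  obtain k where m: "m = Suc k"
    using assms(4) by (cases m) auto
  have "(\<Sum>n\<le>N + m. (nbr_sum ^^ m) f n) = (\<Sum>n\<le>Suc N + k. (nbr_sum ^^ k) (nbr_sum f) n)"
    by (simp add: funpow_swap1 m)
  also have "\<dots> \<le> 2 ^ k * (\<Sum>n\<le>Suc N. nbr_sum f n)"
    using assms nbr_power_nonneg[of "\<lambda>_. 1" "\<lambda>_. 1" f 1]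
    by (intro sum_nbr_sum_power_le) (auto intro: nbr_support)
  also have "\<dots> = 2 ^ k * (2 * (\<Sum>n\<le>N. f n) - f 1)"
    using assms by (simp only: sum_nbr_sum)
  finally show ?thesis
    by (simp add: m algebra_simps)
qed

text \<open>Cauchy-Schwarz for the vectors \<open>(c * sqrt A, d * sqrt C)\<close> and
  \<open>(sqrt B, sqrt D)\<close>, in the form needed when \<open>X\<close> and \<open>Y\<close> are
  themselves bounded by earlier Cauchy-Schwarz estimates.\<close>

lemma cauchy_schwarz_pair:
  fixes X Y :: real
  assumes "X\<^sup>2 \<le> A * B" "Y\<^sup>2 \<le> C * D" "A \<ge> 0" "B \<ge> 0" "C \<ge> 0" "D \<ge> 0"
  shows "(c * X + d * Y)\<^sup>2 \<le> (c\<^sup>2 * A + d\<^sup>2 * C) * (B + D)"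
proof -
  have X: "\<bar>X\<bar> \<le> sqrt (A * B)" and Y: "\<bar>Y\<bar> \<le> sqrt (C * D)"
    using assms real_le_rsqrt[of "\<bar>X\<bar>"] real_le_rsqrt[of "\<bar>Y\<bar>"] by auto
  have "2 * (c * X) * (d * Y) \<le> 2 * (\<bar>c\<bar> * sqrt (A * B)) * (\<bar>d\<bar> * sqrt (C * D))"
  proof -
    have "(c * X) * (d * Y) \<le> \<bar>c * X\<bar> * \<bar>d * Y\<bar>"
      by (metis abs_ge_self abs_mult)
    also have "\<dots> \<le> (\<bar>c\<bar> * sqrt (A * B)) * (\<bar>d\<bar> * sqrt (C * D))"
      unfolding abs_mult using X Y assms by (intro mult_mono) auto
    finally show ?thesis by simp
  qed
  \<comment> \<open>Exchanging \<open>B\<close> and \<open>D\<close> between the factors lets the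
    arithmetic-geometric mean inequality produce exactly the mixed terms of the right-hand
    side.\<close>
  also have "\<dots> = 2 * (\<bar>c\<bar> * sqrt (A * D)) * (\<bar>d\<bar> * sqrt (C * B))"
    by (simp add: real_sqrt_mult)
  also have "\<dots> \<le> (\<bar>c\<bar> * sqrt (A * D))\<^sup>2 + (\<bar>d\<bar> * sqrt (C * B))\<^sup>2"
    by (rule sum_squares_bound)
  also have "\<dots> = c\<^sup>2 * (A * D) + d\<^sup>2 * (C * B)"
    using assms by (simp add: power_mult_distrib)
  finally have 1: "2 * (c * X) * (d * Y) \<le> c\<^sup>2 * (A * D) + d\<^sup>2 * (C * B)" .
  have "c\<^sup>2 * X\<^sup>2 \<le> c\<^sup>2 * (A * B)" "d\<^sup>2 * Y\<^sup>2 \<le> d\<^sup>2 * (C * D)"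
    using assms by (auto intro: mult_left_mono)
  then show ?thesis
    using 1 by (simp add: power2_sum power_mult_distrib algebra_simps)
qed

text \<open>Cauchy-Schwarz over the walks of length \<open>m\<close> from \<open>n\<close>, by
  induction on the first step: the first factor adds up the squared weights of the walks, the second
  the squares of \<open>x\<close> at their end points.\<close>

lemma nbr_power_square_le:
  assumes x: "x 0 = 0"
  shows "((nbr c d ^^ m) x n)\<^sup>2 \<le>
    (nbr (\<lambda>n. (c n)\<^sup>2) (\<lambda>n. (d n)\<^sup>2) ^^ m) (\<lambda>n. if n = 0 then 0 else 1) n *
    (nbr_sum ^^ m) (\<lambda>n. (x n)\<^sup>2) n"
proof (induction m arbitrary: n)
  case 0
  then show ?case using x by simp
next
  case (Suc m)
  show ?case
  proof (cases "n = 0")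
    case False
    let ?A = "(nbr (\<lambda>n. (c n)\<^sup>2) (\<lambda>n. (d n)\<^sup>2) ^^ m) (\<lambda>n. if n = 0 then 0 else 1)"
    let ?B = "(nbr_sum ^^ m) (\<lambda>n. (x n)\<^sup>2)"
    have A: "?A k \<ge> 0" and B: "?B k \<ge> 0" for k
      by (intro nbr_power_nonneg; simp)+
    show ?thesis
      using cauchy_schwarz_pair[OF Suc[of "n + 1"] Suc[of "n - 1"] A B A B, of "c n" "d n"] False
      by (simp add: nbr_pos)
  qed simp
qed

text \<open>Let \<open>S N\<close> be the partial sums of the squares and \<open>L\<close> their
  supposed limit. Testing on truncations of \<open>u\<close> gives \<open>bound\<close>, whose limit
  is impossible for \<open>L > 0\<close>. The loss \<open>(u 1)\<^sup>2 / 2\<close> is independent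
  of \<open>N\<close> and so survives the limit, although the estimate \<open>g\<close> is not
  strict.\<close>

lemma tridiagonal_null_solution_not_l2:
  fixes a b u :: "nat \<Rightarrow> real"
  assumes b: "\<And>n. n \<ge> 1 \<Longrightarrow> b n \<noteq> 0"
    and m: "m \<ge> 1"
    and g: "\<And>n. n \<ge> 1 \<Longrightarrow>
      (nbr (\<lambda>n. (a n / b (n + 1))\<^sup>2) (\<lambda>n. (a (n - 1) / b (n - 1))\<^sup>2) ^^ m)
        (\<lambda>n. if n = 0 then 0 else 1) n \<le> 1 / 2 ^ m"
    and u: "u 0 = 0" "u 1 \<noteq> 0"
      "\<And>n. n \<ge> 1 \<Longrightarrow> a n * u (n + 1) + b n * u n + a (n - 1) * u (n - 1) = 0"
  shows "\<not> summable (\<lambda>n. (u n)\<^sup>2)"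
proof
  assume sum: "summable (\<lambda>n. (u n)\<^sup>2)"
  let ?c = "\<lambda>n. a n / b (n + 1)" and ?d = "\<lambda>n. a (n - 1) / b (n - 1)"
  let ?g = "(nbr (\<lambda>n. (?c n)\<^sup>2) (\<lambda>n. (?d n)\<^sup>2) ^^ m) (\<lambda>n. if n = 0 then 0 else 1)"
  define S where "S N = (\<Sum>n\<le>N. (u n)\<^sup>2)" for N
  define L where "L = (\<Sum>n. (u n)\<^sup>2)"
  have S_le: "S N \<le> L" for N
    unfolding S_def L_def using sum by (intro sum_le_suminf) auto
  have S_lim: "S \<longlonglongrightarrow> L"
    using summable_LIMSEQ'[OF sum] by (simp add: S_def[abs_def] L_def)
  \<comment> \<open>Transposition gives both weights the denominator \<open>b n\<close>, so this is
    the recursion for \<open>u\<close> divided by \<open>b n\<close>.\<close>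
  have eigen: "?d (n + 1) * u (n + 1) + ?c (n - 1) * u (n - 1) = - u n" if "n \<ge> 1" for n
    using u(3)[OF that] b[OF that] that by (simp add: field_simps)
  have g': "?g n \<le> 1 / 2 ^ m" for n
    using g[of n] by (cases "n = 0") auto
  have bound: "(S N)\<^sup>2 \<le> (S N - (u 1)\<^sup>2 / 2) * L" if N: "N \<ge> 1" for N
  proof -
    \<comment> \<open>The truncation has finite support, and its pairing with \<open>u\<close> is
      its own squared norm \<open>S N\<close>.\<close>
    define x where "x n = (if n \<le> N then u n else 0)" for n
    let ?Kx = "(nbr ?c ?d ^^ m) x" and ?Rx = "(nbr_sum ^^ m) (\<lambda>n. (x n)\<^sup>2)"
    have x0: "x 0 = 0" and xN: "\<And>n. n > N \<Longrightarrow> x n = 0"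
      by (simp_all add: x_def u)
    have Rx: "?Rx n \<ge> 0" for n
      by (intro nbr_power_nonneg) auto
    have xu: "(\<Sum>n\<le>N. x n * u n) = S N"
      unfolding S_def by (intro sum.cong) (auto simp: x_def power2_eq_square)
    have xx: "(\<Sum>n\<le>N. (x n)\<^sup>2) = S N"
      unfolding S_def by (intro sum.cong) (auto simp: x_def)
    have "(\<Sum>n\<le>N + m. ?Kx n * u n) = (-1) ^ m * (\<Sum>n\<le>N. x n * u n)"
      by (rule nbr_power_eigen) (fact u(1), fact eigen, fact x0, fact xN)
    then have "(S N)\<^sup>2 = (\<Sum>n\<le>N + m. ?Kx n * u n)\<^sup>2"
      unfolding xu by (simp only: power_mult_distrib) (simp flip: power_mult)
    also have "\<dots> \<le> (\<Sum>n\<le>N + m. (?Kx n)\<^sup>2) * (\<Sum>n\<le>N + m. (u n)\<^sup>2)"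
      by (rule Cauchy_Schwarz_ineq_sum)
    also have "\<dots> \<le> (\<Sum>n\<le>N + m. 1 / 2 ^ m * ?Rx n) * L"
    proof (intro mult_mono sum_mono)
      show "(?Kx n)\<^sup>2 \<le> 1 / 2 ^ m * ?Rx n" for n
        using nbr_power_square_le[where x = x and c = ?c and d = ?d and m = m and n = n, OF x0] mult_right_mono[OF g'[of n] Rx[of n]]
        by linarith
    qed (use S_le[of "N + m"] Rx in \<open>auto simp: S_def intro!: sum_nonneg\<close>)
    also have "\<dots> = (\<Sum>n\<le>N + m. ?Rx n) / 2 ^ m * L"
      by (simp add: sum_divide_distrib)
    also have "\<dots> \<le> (S N - (u 1)\<^sup>2 / 2) * L"
    proof (rule mult_right_mono)
      have "(\<Sum>n\<le>N + m. ?Rx n) \<le> 2 ^ m * (S N - (x 1)\<^sup>2 / 2)"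
        using sum_nbr_sum_power_le_strict[of "\<lambda>n. (x n)\<^sup>2" N m] x0 xN m by (simp add: xx)
      then show "(\<Sum>n\<le>N + m. ?Rx n) / 2 ^ m \<le> S N - (u 1)\<^sup>2 / 2"
        using N by (simp add: field_simps x_def)
      show "L \<ge> 0"
        using S_le[of 0] by (simp add: S_def u)
    qed
    finally show ?thesis .
  qed
  have "L\<^sup>2 \<le> (L - (u 1)\<^sup>2 / 2) * L"
  proof (rule LIMSEQ_le)
    show "(\<lambda>N. (S N)\<^sup>2) \<longlonglongrightarrow> L\<^sup>2"
      by (intro tendsto_intros S_lim)
    show "(\<lambda>N. (S N - (u 1)\<^sup>2 / 2) * L) \<longlonglongrightarrow> (L - (u 1)\<^sup>2 / 2) * L"
      by (intro tendsto_intros S_lim)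
    show "\<exists>N. \<forall>n\<ge>N. (S n)\<^sup>2 \<le> (S n - (u 1)\<^sup>2 / 2) * L"
      using bound by blast
  qed
  moreover have "L > 0"
  proof -
    have "0 < (u 1)\<^sup>2"
      using u(2) by simp
    also have "\<dots> \<le> L"
      using S_le[of 1] u(1) by (simp add: S_def)
    finally show ?thesis .
  qed
  ultimately have "L \<le> L - (u 1)\<^sup>2 / 2"
    by (simp add: power2_eq_square)
  then show False
    using u(2) by simp
qed

section \<open>Recursion for the path sums\<close>

text \<open>A summand of \<open>G_tilde a b m n\<close> is a walk of \<open>m\<close> unit steps from \<open>n\<close>; dropping the last
  entries of \<open>j\<close> and \<open>k\<close> removes its first step.\<close>

lemma multi_indices_Suc:
  "multi_indices (Suc m) =
    (\<lambda>(j, k). (j @ [j ! m + 1], k @ [j ! m + 1])) ` multi_indices m \<union>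
    (\<lambda>(j, k). (j @ [j ! m - 1], k @ [j ! m])) ` multi_indices m" (is "?L = ?R")
proof
  show "?R \<subseteq> ?L"
  proof -
    have "(j @ [x], k @ [y]) \<in> multi_indices (Suc m)"
      if jk: "(j, k) \<in> multi_indices m"
        and xy: "(x = j ! m + 1 \<and> y = j ! m + 1) \<or> (x = j ! m - 1 \<and> y = j ! m)" for j k x y
    proof -
      have len: "length j = m + 1" "length k = m"
        using jk by (auto simp: multi_indices_def)
      have "(k @ [y]) ! s = (j @ [x]) ! s \<and> (j @ [x]) ! s = (j @ [x]) ! (s + 1) + 1 \<or>
          (k @ [y]) ! s = (j @ [x]) ! s + 1 \<and> (j @ [x]) ! s + 1 = (j @ [x]) ! (s + 1)"
        if "s < Suc m" for s
      proof (cases "s = m")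
        case True
        then show ?thesis using xy len by (auto simp: nth_append)
      next
        case False
        then have "s < m" using that by simp
        then show ?thesis using jk len by (auto simp: nth_append multi_indices_def)
      qed
      then show ?thesis
        using jk by (auto simp: multi_indices_def nth_append)
    qed
    then show ?thesis
      by auto
  qed
  show "?L \<subseteq> ?R"
  proof
    fix jk assume "jk \<in> ?L"
    then obtain j k where jk: "jk = (j, k)" "(j, k) \<in> multi_indices (Suc m)"
      by (cases jk) auto
    obtain j' x where j: "j = j' @ [x]"
      using jk by (cases j rule: rev_cases) (auto simp: multi_indices_def)
    obtain k' y where k: "k = k' @ [y]"
      using jk by (cases k rule: rev_cases) (auto simp: multi_indices_def)
    have len: "length j' = m + 1" "length k' = m"
      using jk(2) by (auto simp: multi_indices_def j k)
    then have "j' \<noteq> []"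
      by auto
    then have j0: "j' ! 0 = 0"
      using jk(2) by (auto simp: multi_indices_def j nth_append)
    have step: "(k ! s = j ! s \<and> j ! s = j ! (s + 1) + 1) \<or>
              (k ! s = j ! s + 1 \<and> j ! s + 1 = j ! (s + 1))" if "s < Suc m" for s
      using jk(2) that by (auto simp: multi_indices_def)
    have "(k' ! s = j' ! s \<and> j' ! s = j' ! (s + 1) + 1) \<or>
        (k' ! s = j' ! s + 1 \<and> j' ! s + 1 = j' ! (s + 1))" if "s < m" for s
      using step[of s] that len by (simp add: j k nth_append)
    then have "(j', k') \<in> multi_indices m"
      using len j0 by (simp add: multi_indices_def)
    moreover have "(x = j' ! m + 1 \<and> y = j' ! m + 1) \<or> (x = j' ! m - 1 \<and> y = j' ! m)"
      using step[of m] len by (auto simp: j k nth_append)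
    ultimately show "jk \<in> ?R"
      unfolding jk j k by (force simp: image_iff)
  qed
qed

text \<open>The last entry of \<open>j\<close> is the offset in all indices: changing it from
  \<open>j ! m\<close> to \<open>j ! m + 1\<close> or \<open>j ! m - 1\<close> turns the old factors
  into those for the start \<open>n + 1\<close> or \<open>n - 1\<close>, and the new factor is the
  weight of the step leading there. For \<open>n \<ge> 2\<close> the indices of the new factor are
  positive.\<close>

lemma G_summand_append:
  assumes "(j, k) \<in> multi_indices m" "n \<ge> 2"
  shows "G_summand a b (Suc m) n (j @ [j ! m + 1]) (k @ [j ! m + 1]) =
      ennreal ((a n)\<^sup>2) / ennreal ((b (n + 1))\<^sup>2) * G_summand a b m (n + 1) j k" (is ?up)
    and "G_summand a b (Suc m) n (j @ [j ! m - 1]) (k @ [j ! m]) =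
      ennreal ((a (n - 1))\<^sup>2) / ennreal ((b (n - 1))\<^sup>2) * G_summand a b m (n - 1) j k" (is ?down)
proof -
  have len: "length j = m + 1" "length k = m"
    using assms(1) by (auto simp: multi_indices_def)
  have nth: "(j @ [x]) ! s = j ! s" "(k @ [x]) ! s = k ! s" if "s < m" for s x
    using that len by (auto simp: nth_append)
  have last: "(j @ [x]) ! Suc m = x" "(k @ [x]) ! m = x" "(j @ [x]) ! m = j ! m" for x
    using len by (auto simp: nth_append)
  have n: "nat (int n - 1) = n - 1" "int (n - 1) = int n - 1" "nat (1 + int n) = n + 1"
    using assms(2) by auto
  show ?up
    using assms(2)
    by (auto simp: G_summand_def All_less_Suc nth last n algebra_simps less_Suc_eq)
  show ?down
    using assms(2)
    by (auto simp: G_summand_def All_less_Suc nth last n algebra_simps less_Suc_eq)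
qed

lemma G_tilde_0: "G_tilde a b 0 n = 1"
proof -
  have "multi_indices 0 = {([0], [])}"
    by (auto simp: multi_indices_def length_Suc_conv)
  then show ?thesis
    by (simp add: G_tilde_def G_summand_def)
qed

text \<open>Splits the walks by the direction of the first step. Up to the behaviour at the lower
  end this is one application of \<open>nbr\<close> with squared weights, which makes the path sums
  comparable with \<open>nbr_power_square_le\<close>.\<close>

lemma G_tilde_Suc:
  assumes "n \<ge> 2"
  shows "G_tilde a b (Suc m) n =
    ennreal ((a n)\<^sup>2) / ennreal ((b (n + 1))\<^sup>2) * G_tilde a b m (n + 1) +
    ennreal ((a (n - 1))\<^sup>2) / ennreal ((b (n - 1))\<^sup>2) * G_tilde a b m (n - 1)"
proof -
  let ?f = "\<lambda>(j :: int list, k :: int list). (j @ [j ! m + 1], k @ [j ! m + 1])"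
  let ?g = "\<lambda>(j :: int list, k :: int list). (j @ [j ! m - 1], k @ [j ! m])"
  let ?G = "\<lambda>(j, k). G_summand a b (Suc m) n j k"
  have "G_tilde a b (Suc m) n = sum ?G (?f ` multi_indices m) + sum ?G (?g ` multi_indices m)"
    unfolding G_tilde_def multi_indices_Suc
    by (intro sum.union_disjoint finite_imageI finite_multi_indices) auto
  also have "sum ?G (?f ` multi_indices m) = (\<Sum>jk\<in>multi_indices m. ?G (?f jk))"
    by (subst sum.reindex) (auto simp: inj_on_def)
  also have "\<dots> = (\<Sum>jk\<in>multi_indices m. ennreal ((a n)\<^sup>2) / ennreal ((b (n + 1))\<^sup>2) *
      (case jk of (j, k) \<Rightarrow> G_summand a b m (n + 1) j k))"
    using assms by (intro sum.cong) (auto simp: G_summand_append(1))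
  also have "sum ?G (?g ` multi_indices m) = (\<Sum>jk\<in>multi_indices m. ?G (?g jk))"
    by (subst sum.reindex) (auto simp: inj_on_def)
  also have "\<dots> = (\<Sum>jk\<in>multi_indices m. ennreal ((a (n - 1))\<^sup>2) / ennreal ((b (n - 1))\<^sup>2) *
      (case jk of (j, k) \<Rightarrow> G_summand a b m (n - 1) j k))"
    using assms by (intro sum.cong) (auto simp: G_summand_append(2))
  finally show ?thesis
    by (simp add: G_tilde_def sum_distrib_left)
qed

text \<open>In \<open>ennreal\<close> the product of 0 and \<open>top\<close> is 0, so an infinite
  weight forces an infinite path sum only if the remaining path sum is positive. The walk that
  always steps up suffices for this.\<close>

lemma G_tilde_pos:
  assumes "\<And>n. n \<ge> 1 \<Longrightarrow> a n > 0" "n \<ge> 2"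
  shows "G_tilde a b m n > 0"
  using assms(2)
proof (induction m arbitrary: n)
  case 0
  then show ?case by (simp add: G_tilde_0)
next
  case (Suc m)
  have "ennreal ((a n)\<^sup>2) / ennreal ((b (n + 1))\<^sup>2) * G_tilde a b m (n + 1) > 0"
    using Suc.IH[of "n + 1"] Suc.prems assms(1)[of n]
    by (auto simp: ennreal_zero_less_mult_iff ennreal_zero_less_divide)
  then show ?case
    using Suc.prems by (simp add: G_tilde_Suc add_pos_nonneg)
qed

text \<open>If this denominator vanished, the upward first step would have infinite weight, and with
  it the whole path sum.\<close>

lemma G_tilde_finite_imp_nonzero:
  assumes "\<And>n. n \<ge> 1 \<Longrightarrow> a n > 0" "n \<ge> 2" "m \<ge> 1" "G_tilde a b m n < top"
  shows "b (n + 1) \<noteq> 0"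
proof
  assume "b (n + 1) = 0"
  moreover obtain k where m: "m = Suc k"
    using assms(3) by (cases m) auto
  ultimately have "ennreal ((a n)\<^sup>2) / ennreal ((b (n + 1))\<^sup>2) * G_tilde a b k (n + 1) = top"
    using assms(1)[of n] assms(2) G_tilde_pos[of a "n + 1" b k, OF assms(1)]
    by (simp add: ennreal_top_mult zero_less_iff_neq_zero)
  then have "G_tilde a b m n = top"
    using assms(2) by (simp add: m G_tilde_Suc)
  then show False
    using assms(4) by simp
qed

text \<open>The left side is the path sum of the tail beyond \<open>M\<close>: a walk that reaches
  \<open>M\<close> is killed, whereas on the right it may continue. Otherwise both sides obey the
  same recursion.\<close>

lemma nbr_power_le_G_tilde:
  assumes b: "\<And>n. n \<ge> 1 \<Longrightarrow> b (M + n) \<noteq> 0" and M: "M \<ge> 1" and n: "n \<ge> 1"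
  shows "ennreal ((nbr (\<lambda>n. (a (M + n) / b (M + (n + 1)))\<^sup>2)
      (\<lambda>n. (a (M + (n - 1)) / b (M + (n - 1)))\<^sup>2) ^^ m) (\<lambda>n. if n = 0 then 0 else 1) n)
    \<le> G_tilde a b m (M + n)"
  using n
proof (induction m arbitrary: n)
  case 0
  then show ?case by (simp add: G_tilde_0)
next
  case (Suc m)
  let ?c = "\<lambda>n. (a (M + n) / b (M + (n + 1)))\<^sup>2"
  let ?d = "\<lambda>n. (a (M + (n - 1)) / b (M + (n - 1)))\<^sup>2"
  define A where "A = (nbr ?c ?d ^^ m) (\<lambda>n. if n = 0 then 0 else 1)"
  have A: "A k \<ge> 0" for k
    unfolding A_def by (intro nbr_power_nonneg) auto
  have IH: "ennreal (A k) \<le> G_tilde a b m (M + k)" if "k \<ge> 1" for k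
    using Suc.IH[OF that] by (simp only: A_def)
  have weight: "ennreal ((a i / b (M + k))\<^sup>2 * A k) \<le>
      ennreal ((a i)\<^sup>2) / ennreal ((b (M + k))\<^sup>2) * G_tilde a b m (M + k)" if "k \<ge> 1" for i k
  proof -
    have "ennreal ((a i / b (M + k))\<^sup>2 * A k) =
        ennreal ((a i)\<^sup>2) / ennreal ((b (M + k))\<^sup>2) * ennreal (A k)"
      using b[OF that] A[of k] by (simp add: power_divide divide_ennreal flip: ennreal_mult)
    also have "\<dots> \<le> ennreal ((a i)\<^sup>2) / ennreal ((b (M + k))\<^sup>2) * G_tilde a b m (M + k)"
      using IH[OF that] by (intro mult_left_mono) auto
    finally show ?thesis .
  qed
  have up: "ennreal (?c n * A (n + 1)) \<le>
      ennreal ((a (M + n))\<^sup>2) / ennreal ((b (M + n + 1))\<^sup>2) * G_tilde a b m (M + n + 1)"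
    using weight[of "n + 1" "M + n"] by simp
  have down: "ennreal (?d n * A (n - 1)) \<le>
      ennreal ((a (M + n - 1))\<^sup>2) / ennreal ((b (M + n - 1))\<^sup>2) * G_tilde a b m (M + n - 1)"
  \<comment> \<open>From \<open>n = 1\<close> the downward step reaches the killing point, where
    \<open>A 0 = 0\<close>. Nothing is known about \<open>b M\<close>, so \<open>weight\<close> does
    not cover this case.\<close>
  proof (cases "n = 1")
    case True
    then show ?thesis by (simp add: A_def)
  next
    case False
    then have "n - 1 \<ge> 1" "M + n - 1 = M + (n - 1)"
      using Suc.prems by auto
    then show ?thesis
      using weight[of "n - 1" "M + (n - 1)"] by simp
  qed
  have "(nbr ?c ?d ^^ Suc m) (\<lambda>n. if n = 0 then 0 else 1) n = ?c n * A (n + 1) + ?d n * A (n - 1)"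
    using Suc.prems by (simp add: nbr_pos A_def)
  then show ?case
    using add_mono[OF up down] A Suc.prems M by (simp add: G_tilde_Suc ennreal_plus)
qed

section \<open>Wronskians\<close>

text \<open>Since \<open>1 + t n \<le> exp (t n)\<close>, the growth factors multiply to at most the
  exponential of a partial sum of \<open>t\<close>.\<close>

lemma discrete_gronwall_bounded:
  fixes R t :: "nat \<Rightarrow> real"
  assumes R: "\<And>n. n \<ge> M \<Longrightarrow> R (Suc n) \<le> R n * (1 + t (Suc n))" "\<And>n. R n \<ge> 0"
    and t: "summable t" "\<And>n. t n \<ge> 0"
  obtains B where "B \<ge> 0" "\<And>n. n \<ge> M \<Longrightarrow> R n \<le> B"
proof
  have step: "R n \<le> R M * exp (\<Sum>k\<le>n. t k)" if "n \<ge> M" for n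
    using that
  proof (induction n rule: dec_induct)
    case base
    have "exp (\<Sum>k\<le>M. t k) \<ge> 1"
      using t(2) by (simp add: sum_nonneg)
    then show ?case
      using R(2)[of M] by (simp add: mult_le_cancel_left1)
  next
    case (step n)
    have "R (Suc n) \<le> R n * (1 + t (Suc n))"
      using R(1) step by simp
    also have "\<dots> \<le> (R M * exp (\<Sum>k\<le>n. t k)) * exp (t (Suc n))"
      using step R(2) t(2) by (intro mult_mono) (auto intro: exp_ge_add_one_self add_nonneg_nonneg)
    also have "\<dots> = R M * exp (\<Sum>k\<le>Suc n. t k)"
      by (simp add: exp_add)
    finally show ?case .
  qed
  show "R n \<le> R M * exp (suminf t)" if "n \<ge> M" for n
  proof -
    have "(\<Sum>k\<le>n. t k) \<le> suminf t"
      using t by (intro sum_le_suminf) auto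
    then have "R M * exp (\<Sum>k\<le>n. t k) \<le> R M * exp (suminf t)"
      using R(2) by (intro mult_left_mono) auto
    then show ?thesis
      using step[OF that] by linarith
  qed
  show "R M * exp (suminf t) \<ge> 0"
    using R(2) by simp
qed

lemma summable_mult_l2:
  fixes f g :: "nat \<Rightarrow> 'a :: real_normed_vector"
  assumes "summable (\<lambda>n. (norm (f n))\<^sup>2)" "summable (\<lambda>n. (norm (g n))\<^sup>2)"
  shows "summable (\<lambda>n. norm (f n) * norm (g n))"
proof (rule summable_comparison_test'[where N = 0])
  show "summable (\<lambda>n. (norm (f n))\<^sup>2 + (norm (g n))\<^sup>2)"
    using assms by (rule summable_add)
  show "norm (norm (f n) * norm (g n)) \<le> (norm (f n))\<^sup>2 + (norm (g n))\<^sup>2" for n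
  proof -
    have "2 * (norm (f n) * norm (g n)) \<le> (norm (f n))\<^sup>2 + (norm (g n))\<^sup>2"
      using sum_squares_bound[of "norm (f n)" "norm (g n)"] by (simp only: mult.assoc)
    moreover have "norm (f n) * norm (g n) \<ge> 0"
      by simp
    ultimately show ?thesis
      by (simp only: real_norm_def abs_of_nonneg)
  qed
qed

text \<open>Variation of constants. A nonzero limit keeps \<open>x\<close> and \<open>y\<close>
  independent from some index on, so \<open>u\<close> combines them with coefficients
  \<open>W u y\<close> and \<open>W x u\<close> divided by \<open>W x y\<close>. The size
  \<open>R\<close> of these coefficients grows by factors \<open>1 + t\<close> with summable
  \<open>t\<close>, so it stays bounded and \<open>u\<close> inherits square summability.\<close>

lemma wronskian_tendsto_0:
  fixes a b :: "nat \<Rightarrow> real" and u x y f g :: "nat \<Rightarrow> complex"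
  defines "W \<equiv> \<lambda>(p :: nat \<Rightarrow> complex) (q :: nat \<Rightarrow> complex) n. complex_of_real (a n) * (p (n + 1) * q n - p n * q (n + 1))"
  assumes u: "\<And>n. n > M \<Longrightarrow> a n * u (n + 1) + b n * u n + a (n - 1) * u (n - 1) = 0"
      "\<not> summable (\<lambda>n. (norm (u n))\<^sup>2)"
    and x: "\<And>n. n > M \<Longrightarrow> a n * x (n + 1) + b n * x n + a (n - 1) * x (n - 1) = f n"
    and y: "\<And>n. n > M \<Longrightarrow> a n * y (n + 1) + b n * y n + a (n - 1) * y (n - 1) = g n"
    and l2: "summable (\<lambda>n. (norm (x n))\<^sup>2)" "summable (\<lambda>n. (norm (y n))\<^sup>2)"
      "summable (\<lambda>n. (norm (f n))\<^sup>2)" "summable (\<lambda>n. (norm (g n))\<^sup>2)"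
    and lim: "W x y \<longlonglongrightarrow> w"
  shows "w = 0"
proof (rule ccontr)
  assume "w \<noteq> 0"
  then have "norm w / 2 < norm w"
    by simp
  moreover have "(\<lambda>n. norm (W x y n)) \<longlonglongrightarrow> norm w"
    by (intro tendsto_norm lim)
  ultimately have "\<forall>\<^sub>F n in sequentially. norm w / 2 < norm (W x y n)"
    by (rule order_tendstoD(1)[rotated])
  then obtain N0 where N0: "\<And>n. n \<ge> N0 \<Longrightarrow> norm w / 2 < norm (W x y n)"
    by (auto simp: eventually_sequentially)
  define N where "N = max N0 M"
  define C where "C = 2 / norm w"
  have C: "C > 0"
    using \<open>w \<noteq> 0\<close> by (simp add: C_def)
  define R where "R n = norm (W u y n) + norm (W x u n)" for n
  define t where "t n = C * (norm (x n) + norm (y n)) * (norm (f n) + norm (g n))" for n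
  \<comment> \<open>Green's identity in difference form: the terms with \<open>b\<close> cancel, and
    those with \<open>a n\<close> form the previous Wronskian.\<close>
  have green: "W p q (Suc n) - W p q n = h (Suc n) * q (Suc n) - p (Suc n) * k (Suc n)"
    if "n \<ge> M" and
      "\<And>n. n > M \<Longrightarrow> a n * p (n + 1) + b n * p n + a (n - 1) * p (n - 1) = h n"
      "\<And>n. n > M \<Longrightarrow> a n * q (n + 1) + b n * q n + a (n - 1) * q (n - 1) = k n"
    for p q h k :: "nat \<Rightarrow> complex" and n
  proof -
    have "h (Suc n) = a (Suc n) * p (Suc n + 1) + b (Suc n) * p (Suc n) + a n * p n"
      "k (Suc n) = a (Suc n) * q (Suc n + 1) + b (Suc n) * q (Suc n) + a n * q n"
      using that(1) that(2,3)[of "Suc n"] by auto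
    then show ?thesis
      by (simp add: W_def algebra_simps)
  qed
  have u_bound: "norm (u (Suc n)) \<le> C * (norm (x (Suc n)) + norm (y (Suc n))) * R n"
    if "n \<ge> N" for n
  proof -
    \<comment> \<open>Cramer's rule for the values at \<open>n\<close> and \<open>Suc n\<close>,
      read off in the component \<open>Suc n\<close>.\<close>
    have "W x y n * u (Suc n) = W u y n * x (Suc n) + W x u n * y (Suc n)"
      by (simp add: W_def algebra_simps)
    then have "norm (W x y n) * norm (u (Suc n)) \<le>
        norm (W u y n) * norm (x (Suc n)) + norm (W x u n) * norm (y (Suc n))"
      by (metis norm_mult norm_triangle_ineq)
    also have "\<dots> \<le> R n * norm (x (Suc n)) + R n * norm (y (Suc n))"
      by (intro add_mono mult_right_mono) (auto simp: R_def)
    finally have "norm (W x y n) * norm (u (Suc n)) \<le> (norm (x (Suc n)) + norm (y (Suc n))) * R n"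
      by (simp add: algebra_simps)
    moreover have "norm w / 2 * norm (u (Suc n)) \<le> norm (W x y n) * norm (u (Suc n))"
      using N0[of n] that by (intro mult_right_mono) (auto simp: N_def)
    ultimately have "norm w / 2 * norm (u (Suc n)) \<le> (norm (x (Suc n)) + norm (y (Suc n))) * R n"
      by linarith
    then show ?thesis
      using \<open>w \<noteq> 0\<close> by (simp add: C_def field_simps)
  qed
  have R_step: "R (Suc n) \<le> R n * (1 + t (Suc n))" if "n \<ge> N" for n
  proof -
    have M: "n \<ge> M"
      using that by (simp add: N_def)
    have "W u y (Suc n) = W u y n - u (Suc n) * g (Suc n)"
      using green[of n u "\<lambda>_. 0" y g, OF M u(1) y] by (simp add: algebra_simps)
    then have 1: "norm (W u y (Suc n)) \<le> norm (W u y n) + norm (u (Suc n)) * norm (g (Suc n))"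
      by (metis norm_mult norm_triangle_ineq4)
    have "W x u (Suc n) = W x u n + f (Suc n) * u (Suc n)"
      using green[of n x f u "\<lambda>_. 0", OF M x u(1)] by (simp add: algebra_simps)
    then have 2: "norm (W x u (Suc n)) \<le> norm (W x u n) + norm (f (Suc n)) * norm (u (Suc n))"
      by (metis norm_mult norm_triangle_ineq)
    have "R (Suc n) \<le> R n + norm (u (Suc n)) * (norm (f (Suc n)) + norm (g (Suc n)))"
      using 1 2 by (simp add: R_def algebra_simps)
    also have "\<dots> \<le> R n + (C * (norm (x (Suc n)) + norm (y (Suc n))) * R n) *
        (norm (f (Suc n)) + norm (g (Suc n)))"
      using u_bound[OF that] by (intro add_left_mono mult_right_mono) auto
    also have "\<dots> = R n * (1 + t (Suc n))"
      by (simp add: t_def algebra_simps)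
    finally show ?thesis .
  qed
  have "summable t"
  proof -
    have "t = (\<lambda>n. C * (norm (x n) * norm (f n) + norm (x n) * norm (g n) +
        (norm (y n) * norm (f n) + norm (y n) * norm (g n))))"
      by (simp add: t_def fun_eq_iff algebra_simps)
    then show ?thesis
      using l2 by (simp only:) (intro summable_mult summable_add summable_mult_l2)
  qed
  moreover have "t n \<ge> 0" "R n \<ge> 0" for n
    using C by (simp_all add: t_def R_def)
  ultimately obtain B where B: "B \<ge> 0" "\<And>n. n \<ge> N \<Longrightarrow> R n \<le> B"
    using discrete_gronwall_bounded[of N R t] R_step by blast
  have "summable (\<lambda>n. (norm (u (Suc n)))\<^sup>2)"
  proof (rule summable_comparison_test'[where N = N])
    show "summable (\<lambda>n. 2 * (C * B)\<^sup>2 * ((norm (x (Suc n)))\<^sup>2 + (norm (y (Suc n)))\<^sup>2))"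
      using l2(1,2) summable_Suc_iff[of "\<lambda>n. (norm (x n))\<^sup>2"]
        summable_Suc_iff[of "\<lambda>n. (norm (y n))\<^sup>2"]
      by (intro summable_mult summable_add) simp_all
    show "norm ((norm (u (Suc n)))\<^sup>2) \<le>
        2 * (C * B)\<^sup>2 * ((norm (x (Suc n)))\<^sup>2 + (norm (y (Suc n)))\<^sup>2)" if "n \<ge> N" for n
    proof -
      let ?x = "norm (x (Suc n))" and ?y = "norm (y (Suc n))"
      have "norm (u (Suc n)) \<le> C * (?x + ?y) * B"
      proof -
        have "C * (?x + ?y) * R n \<le> C * (?x + ?y) * B"
          using B(2)[OF that] C by (intro mult_left_mono) auto
        then show ?thesis
          using u_bound[OF that] by linarith
      qed
      then have "(norm (u (Suc n)))\<^sup>2 \<le> (C * (?x + ?y) * B)\<^sup>2"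
        by (intro power_mono) auto
      also have "\<dots> = (C * B)\<^sup>2 * (?x + ?y)\<^sup>2"
        by (simp add: power_mult_distrib)
      also have "\<dots> \<le> (C * B)\<^sup>2 * (2 * (?x\<^sup>2 + ?y\<^sup>2))"
        using sum_squares_bound[of ?x ?y] by (intro mult_left_mono) (auto simp: power2_sum)
      finally show ?thesis
        by (simp add: algebra_simps)
    qed
  qed
  then show False
    using u(2) summable_Suc_iff[of "\<lambda>n. (norm (u n))\<^sup>2"] by simp
qed

section \<open>Closures and adjoints in Hilbert space\<close>

text \<open>A minimising sequence for the distance is Cauchy by the parallelogram law, and varying
  the minimiser along \<open>v\<close> gives orthogonality. The form is real because graphs lie in
  the product space, used here with its real inner product.\<close>

lemma orthogonal_projection_exists:
  fixes S :: "'a :: {real_inner, complete_space} set"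
  assumes "closed S" "subspace S"
  shows "\<exists>p\<in>S. \<forall>s\<in>S. inner (x - p) s = 0"
proof -
  define D where "D = (\<lambda>s. (norm (x - s))\<^sup>2) ` S"
  have D: "bdd_below D" "D \<noteq> {}"
    using subspace_0[OF assms(2)] by (auto simp: D_def intro!: bdd_belowI[where m = 0])
  have Inf_le: "Inf D \<le> (norm (x - s))\<^sup>2" if "s \<in> S" for s
    using that D by (intro cInf_lower) (auto simp: D_def)
  have "\<exists>s\<in>S. (norm (x - s))\<^sup>2 < Inf D + inverse (real (Suc n))" for n
    using cInf_lessD[OF D(2), of "Inf D + inverse (real (Suc n))"] by (auto simp: D_def)
  then obtain s where s: "\<And>n. s n \<in> S"
    "\<And>n. (norm (x - s n))\<^sup>2 < Inf D + inverse (real (Suc n))"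
    by metis
  have diff: "(norm (s m - s n))\<^sup>2 \<le> 2 * inverse (real (Suc m)) + 2 * inverse (real (Suc n))" for m n
  proof -
    have "(1 / 2) *\<^sub>R (s m + s n) \<in> S"
      using s(1) assms(2) by (intro subspace_scale subspace_add)
    then have "Inf D \<le> (norm (x - (1 / 2) *\<^sub>R (s m + s n)))\<^sup>2"
      by (rule Inf_le)
    \<comment> \<open>Parallelogram law for \<open>x - s m\<close> and
      \<open>x - s n\<close>.\<close>
    moreover have "(norm (s m - s n))\<^sup>2 + 4 * (norm (x - (1 / 2) *\<^sub>R (s m + s n)))\<^sup>2 =
        2 * (norm (x - s m))\<^sup>2 + 2 * (norm (x - s n))\<^sup>2"
      by (simp add: power2_norm_eq_inner inner_diff_left inner_diff_right inner_add_left
          inner_add_right inner_commute algebra_simps)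
    ultimately show ?thesis
      using s(2)[of m] s(2)[of n] by linarith
  qed
  have "Cauchy s"
  proof (rule CauchyI)
    fix e :: real assume "e > 0"
    then obtain N where N: "inverse (real (Suc N)) < e\<^sup>2 / 4"
      using reals_Archimedean[of "e\<^sup>2 / 4"] by auto
    have "norm (s m - s n) < e" if "m \<ge> N" "n \<ge> N" for m n
    proof -
      have "inverse (real (Suc m)) \<le> inverse (real (Suc N))"
        "inverse (real (Suc n)) \<le> inverse (real (Suc N))"
        using that by auto
      then have "(norm (s m - s n))\<^sup>2 < e\<^sup>2"
        using diff[of m n] N by linarith
      then show ?thesis
        using \<open>e > 0\<close> by (simp add: power_less_imp_less_base)
    qed
    then show "\<exists>M. \<forall>m\<ge>M. \<forall>n\<ge>M. norm (s m - s n) < e"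
      by blast
  qed
  then obtain p where p: "s \<longlonglongrightarrow> p"
    using convergent_eq_Cauchy by auto
  have "p \<in> S"
    using closed_sequentially[OF assms(1)] s(1) p by blast
  have "(norm (x - p))\<^sup>2 \<le> Inf D + 0"
  proof (rule LIMSEQ_le)
    show "(\<lambda>n. (norm (x - s n))\<^sup>2) \<longlonglongrightarrow> (norm (x - p))\<^sup>2"
      by (intro tendsto_intros p)
    show "(\<lambda>n. Inf D + inverse (real (Suc n))) \<longlonglongrightarrow> Inf D + 0"
      by (intro tendsto_intros LIMSEQ_inverse_real_of_nat)
    show "\<exists>N. \<forall>n\<ge>N. (norm (x - s n))\<^sup>2 \<le> Inf D + inverse (real (Suc n))"
      using s(2) less_imp_le by blast
  qed
  then have min: "(norm (x - p))\<^sup>2 \<le> (norm (x - s))\<^sup>2" if "s \<in> S" for s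
    using Inf_le[OF that] by linarith
  have "inner (x - p) v = 0" if "v \<in> S" for v
  proof (cases "v = 0")
    case False
    \<comment> \<open>The multiple of \<open>v\<close> closest to \<open>x - p\<close>.\<close>
    define t where "t = inner (x - p) v / (norm v)\<^sup>2"
    have "p + t *\<^sub>R v \<in> S"
      using \<open>p \<in> S\<close> that assms(2) by (intro subspace_add subspace_scale)
    then have "(norm (x - p))\<^sup>2 \<le> (norm ((x - p) - t *\<^sub>R v))\<^sup>2"
      using min by (metis diff_diff_add)
    also have "\<dots> = (norm (x - p))\<^sup>2 - 2 * t * inner (x - p) v + t\<^sup>2 * (norm v)\<^sup>2"
      unfolding power2_norm_eq_inner
      by (simp add: inner_diff_left inner_diff_right inner_commute power2_eq_square algebra_simps)
    finally have "2 * t * inner (x - p) v \<le> t\<^sup>2 * (norm v)\<^sup>2"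
      by simp
    moreover have "t * (norm v)\<^sup>2 = inner (x - p) v"
      using False by (simp add: t_def)
    ultimately have "2 * (t * inner (x - p) v) \<le> t * inner (x - p) v"
      by (metis mult.assoc mult.left_commute power2_eq_square)
    then have "t * inner (x - p) v \<le> 0"
      by simp
    then have "(inner (x - p) v)\<^sup>2 / (norm v)\<^sup>2 \<le> 0"
      by (simp add: t_def power2_eq_square)
    then show ?thesis
      using False by (simp add: divide_le_0_iff)
  qed simp
  then show ?thesis
    using \<open>p \<in> S\<close> by blast
qed

section \<open>Complex inner products: algebra and continuity\<close>

lemma scaleC_0_left [simp]: "0 *\<^sub>C x = (0 :: 'a :: complex_hilbert)"
  using scaleC_of_real[of 0 x] by simp

lemma cinner_0_left [simp]: "cinner 0 (y :: 'a :: complex_hilbert) = 0"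
  using cinner_scaleC_left[of 0 0 y] by simp

lemma cinner_0_right [simp]: "cinner x (0 :: 'a :: complex_hilbert) = 0"
  by (subst cinner_commute) simp

lemma cinner_add_right: "cinner x (y + z :: 'a :: complex_hilbert) = cinner x y + cinner x z"
  by (metis cinner_add_left cinner_commute complex_cnj_add)

lemma cinner_scaleC_right: "cinner x (c *\<^sub>C y :: 'a :: complex_hilbert) = cnj c * cinner x y"
  by (metis cinner_scaleC_left cinner_commute complex_cnj_mult)

lemma cinner_scaleR_left: "cinner (r *\<^sub>R x) (y :: 'a :: complex_hilbert) = complex_of_real r * cinner x y"
  by (metis cinner_scaleC_left scaleC_of_real)

lemma cinner_scaleR_right: "cinner x (r *\<^sub>R y :: 'a :: complex_hilbert) = complex_of_real r * cinner x y"
  by (metis cinner_scaleC_right scaleC_of_real complex_cnj_complex_of_real)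

lemma cinner_minus_left: "cinner (- x) (y :: 'a :: complex_hilbert) = - cinner x y"
  using cinner_scaleR_left[of "-1" x y] by simp

lemma cinner_minus_right: "cinner x (- y :: 'a :: complex_hilbert) = - cinner x y"
  using cinner_scaleR_right[of x "-1" y] by simp

lemma cinner_diff_left: "cinner (x - y) (z :: 'a :: complex_hilbert) = cinner x z - cinner y z"
  using cinner_add_left[of x "- y" z] by (simp add: cinner_minus_left)

lemma cinner_diff_right: "cinner x (y - z :: 'a :: complex_hilbert) = cinner x y - cinner x z"
  using cinner_add_right[of x y "- z"] by (simp add: cinner_minus_right)

lemma cinner_sum_left: "cinner (\<Sum>i\<in>A. f i) (y :: 'a :: complex_hilbert) = (\<Sum>i\<in>A. cinner (f i) y)"
  by (induction A rule: infinite_finite_induct) (simp_all add: cinner_add_left)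

lemma cinner_sum_right: "cinner (x :: 'a :: complex_hilbert) (\<Sum>i\<in>A. f i) = (\<Sum>i\<in>A. cinner x (f i))"
  by (induction A rule: infinite_finite_induct) (simp_all add: cinner_add_right)

text \<open>Rotation by \<open>- \<i>\<close> turns the imaginary part into a real one, so
  continuity of \<open>cinner\<close> reduces to that of the real inner product.\<close>

lemma cinner_eq_Complex: "cinner x (y :: 'a :: complex_hilbert) = Complex (inner x y) (inner ((- \<i>) *\<^sub>C x) y)"
  by (simp add: complex_eq_iff inner_eq_Re_cinner cinner_scaleC_left cinner_minus_left)

lemma norm_scaleC: "norm (c *\<^sub>C x) = norm c * norm (x :: 'a :: complex_hilbert)"
proof -
  have "cinner (c *\<^sub>C x) (c *\<^sub>C x) = c * cnj c * cinner x x"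
    by (simp add: cinner_scaleC_left cinner_scaleC_right)
  also have "\<dots> = complex_of_real ((norm c)\<^sup>2) * cinner x x"
    by (simp only: complex_norm_square)
  finally have "inner (c *\<^sub>C x) (c *\<^sub>C x) = (norm c)\<^sup>2 * inner x x"
    by (simp only: inner_eq_Re_cinner Re_complex_of_real times_complex.sel Im_complex_of_real mult_zero_left diff_zero)
  then have "(norm (c *\<^sub>C x))\<^sup>2 = (norm c * norm x)\<^sup>2"
    by (simp only: power2_norm_eq_inner power_mult_distrib)
  then show ?thesis
    by (simp add: power2_eq_iff_nonneg)
qed

lemma bounded_linear_scaleC: "bounded_linear (\<lambda>x :: 'a :: complex_hilbert. c *\<^sub>C x)"
proof (rule bounded_linear_intro)
  show "c *\<^sub>C (x + y) = c *\<^sub>C x + c *\<^sub>C y" for x y :: 'a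
    by (rule scaleC_add_right)
  show "c *\<^sub>C (r *\<^sub>R x) = r *\<^sub>R (c *\<^sub>C x)" for r and x :: 'a
    by (metis scaleC_of_real scaleC_scaleC mult.commute)
  show "norm (c *\<^sub>C x) \<le> norm x * norm c" for x :: 'a
    by (simp add: norm_scaleC)
qed

lemmas tendsto_scaleC = bounded_linear.tendsto[OF bounded_linear_scaleC]

lemma tendsto_cinner:
  fixes x y :: "'a :: complex_hilbert"
  assumes "(f \<longlongrightarrow> x) F" "(g \<longlongrightarrow> y) F"
  shows "((\<lambda>n. cinner (f n) (g n)) \<longlongrightarrow> cinner x y) F"
  unfolding cinner_eq_Complex by (intro tendsto_Complex tendsto_inner tendsto_scaleC assms)

lemma subspace_closure:
  fixes S :: "'a :: real_normed_vector set"
  assumes "subspace S"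
  shows "subspace (closure S)"
  unfolding subspace_def
proof (intro conjI ballI allI)
  show "0 \<in> closure S"
    using subspace_0[OF assms] closure_subset by blast
  show "x + y \<in> closure S" if "x \<in> closure S" "y \<in> closure S" for x y
  proof -
    obtain f where f: "\<forall>n. f n \<in> S" "f \<longlonglongrightarrow> x"
      using \<open>x \<in> closure S\<close> unfolding closure_sequential by blast
    obtain g where g: "\<forall>n. g n \<in> S" "g \<longlonglongrightarrow> y"
      using \<open>y \<in> closure S\<close> unfolding closure_sequential by blast
    from f g have "\<And>n. f n + g n \<in> S" "(\<lambda>n. f n + g n) \<longlonglongrightarrow> x + y"
      using assms by (auto intro: subspace_add tendsto_add)
    then show ?thesis
      unfolding closure_sequential by (intro exI[of _ "\<lambda>n. f n + g n"]) simp
  qed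
  show "r *\<^sub>R x \<in> closure S" if "x \<in> closure S" for r x
  proof -
    obtain f where "\<forall>n. f n \<in> S" "f \<longlonglongrightarrow> x"
      using \<open>x \<in> closure S\<close> unfolding closure_sequential by blast
    then have "\<And>n. r *\<^sub>R f n \<in> S" "(\<lambda>n. r *\<^sub>R f n) \<longlonglongrightarrow> r *\<^sub>R x"
      using assms by (auto intro: subspace_scale tendsto_scaleR)
    then show ?thesis
      unfolding closure_sequential by (intro exI[of _ "\<lambda>n. r *\<^sub>R f n"]) simp
  qed
qed

section \<open>Adjoints as closed graphs\<close>

lemma adjoint_operatorI:
  "(\<And>x w. (x, w) \<in> T \<Longrightarrow> cinner w y = cinner x z) \<Longrightarrow> (y, z) \<in> adjoint_operator T"
  by (auto simp: adjoint_operator_def)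

lemma adjoint_operatorD:
  "(y, z) \<in> adjoint_operator T \<Longrightarrow> (x, w) \<in> T \<Longrightarrow> cinner w y = cinner x z"
  by (auto simp: adjoint_operator_def)

lemma adjoint_operator_antimono: "S \<subseteq> T \<Longrightarrow> adjoint_operator T \<subseteq> adjoint_operator S"
  by (fastforce simp: adjoint_operator_def)

lemma closed_adjoint_operator: "closed (adjoint_operator T)"
  unfolding closed_sequential_limits
proof (intro allI impI, elim conjE)
  fix s :: "nat \<Rightarrow> 'a \<times> 'a" and l
  assume s: "\<forall>n. s n \<in> adjoint_operator T" and l: "s \<longlonglongrightarrow> l"
  have "cinner w (fst l) = cinner x (snd l)" if "(x, w) \<in> T" for x w
  proof (rule LIMSEQ_unique)
    show "(\<lambda>n. cinner w (fst (s n))) \<longlonglongrightarrow> cinner w (fst l)"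
      by (intro tendsto_cinner tendsto_fst l tendsto_const)
    have "cinner w (fst (s n)) = cinner x (snd (s n))" for n
      using s that by (intro adjoint_operatorD[of _ _ T]) auto
    then show "(\<lambda>n. cinner w (fst (s n))) \<longlonglongrightarrow> cinner x (snd l)"
      by (simp only:) (intro tendsto_cinner tendsto_snd l tendsto_const)
  qed
  then show "l \<in> adjoint_operator T"
    by (cases l) (auto simp: adjoint_operator_def)
qed

text \<open>The relation between two pairs is symmetric up to conjugation. A statement about all of
  \<open>T\<close> thus becomes an inclusion of \<open>T\<close> in a closed set, which passes to
  the closure.\<close>

lemma adjoint_operator_swap:
  "(y, z) \<in> adjoint_operator T \<longleftrightarrow> T \<subseteq> adjoint_operator {(y, z)}"
proof -
  have "cinner w y = cinner x z \<longleftrightarrow> cinner z x = cinner y w" for x w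
    using cinner_commute[of z x] cinner_commute[of y w] by auto
  then show ?thesis
    by (auto simp: adjoint_operator_def)
qed

lemma adjoint_operator_closure: "adjoint_operator (closure T) = adjoint_operator T"
proof
  show "adjoint_operator (closure T) \<subseteq> adjoint_operator T"
    by (intro adjoint_operator_antimono closure_subset)
  show "adjoint_operator T \<subseteq> adjoint_operator (closure T)"
  proof
    fix v assume "v \<in> adjoint_operator T"
    then have "T \<subseteq> adjoint_operator {v}"
      by (cases v) (simp only: adjoint_operator_swap)
    then have "closure T \<subseteq> adjoint_operator {v}"
      by (rule closure_minimal[OF _ closed_adjoint_operator])
    then show "v \<in> adjoint_operator (closure T)"
      by (cases v) (simp only: adjoint_operator_swap)
  qed
qed

text \<open>\<open>J (r, s) = (s, -r)\<close> maps the orthogonal complement of the graph of \<open>T\<close> into the graph of the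
  adjoint, and a pair in the latter that is related to \<open>J (r, s)\<close> by symmetry is orthogonal to
  \<open>(r, s)\<close>.\<close>

lemma adjoint_subset_closure_if_symmetric:
  fixes T :: "('a :: complex_hilbert \<times> 'a) set"
  assumes zero: "(0, 0) \<in> T"
    and add: "\<And>x y x' y'. (x, y) \<in> T \<Longrightarrow> (x', y') \<in> T \<Longrightarrow> (x + x', y + y') \<in> T"
    and scale: "\<And>c x y. (x, y) \<in> T \<Longrightarrow> (c *\<^sub>C x, c *\<^sub>C y) \<in> T"
    and sub: "T \<subseteq> adjoint_operator T"
    and sym: "adjoint_operator T \<subseteq> adjoint_operator (adjoint_operator T)"
  shows "adjoint_operator T \<subseteq> closure T"
proof
  fix v assume v: "v \<in> adjoint_operator T"
  have "subspace T"
    unfolding subspace_def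
  proof (intro conjI ballI allI)
    show "0 \<in> T"
      using zero by (simp add: zero_prod_def)
    show "v + w \<in> T" if "v \<in> T" "w \<in> T" for v w
      using add that by (cases v; cases w) simp
    show "r *\<^sub>R v \<in> T" if "v \<in> T" for r v
      using scale[of "fst v" "snd v" "complex_of_real r"] that
      by (simp add: scaleC_of_real scaleR_prod_def)
  qed
  then obtain p where p: "p \<in> closure T" "\<And>s. s \<in> closure T \<Longrightarrow> inner (v - p) s = 0"
    using orthogonal_projection_exists[OF closed_closure, of T v] subspace_closure by blast
  obtain r s where rs: "v - p = (r, s)"
    by (cases "v - p")
  have orth: "cinner x r + cinner w s = 0" if xw: "(x, w) \<in> T" for x w
  proof -
    \<comment> \<open>So far orthogonality is real; as \<open>T\<close> is closed under complex
      multiples, \<open>c = 1\<close> and \<open>c = - \<i>\<close> give the real and the imaginary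
      part.\<close>
    have "inner (c *\<^sub>C x) r + inner (c *\<^sub>C w) s = 0" for c
      using p(2)[of "(c *\<^sub>C x, c *\<^sub>C w)"] closure_subset[of T] scale[OF xw] rs
      by (auto simp: inner_commute)
    from this[of 1] this[of "- \<i>"] show ?thesis
      by (simp add: cinner_eq_Complex scaleC_one complex_eq_iff)
  qed
  have J: "(s, - r) \<in> adjoint_operator T"
  proof -
    have "cinner w s = cinner x (- r)" if "(x, w) \<in> T" for x w
      using orth[OF that] by (simp add: cinner_minus_right eq_neg_iff_add_eq_0 add.commute)
    then show ?thesis
      by (auto simp: adjoint_operator_def)
  qed
  have "closure T \<subseteq> adjoint_operator T"
    by (rule closure_minimal[OF sub closed_adjoint_operator])
  then have "p \<in> adjoint_operator T"
    using p by blast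
  have rel: "inner (r, s) q = 0" if "q \<in> adjoint_operator T" for q
  proof -
    obtain y z where q: "q = (y, z)"
      by (cases q)
    have "q \<in> adjoint_operator (adjoint_operator T)"
      using sym that by blast
    then have "cinner (- r) y = cinner s z"
      using J unfolding q adjoint_operator_def by blast
    then have "Re (cinner (- r) y) = Re (cinner s z)"
      by simp
    then show ?thesis
      by (simp add: q inner_eq_Re_cinner cinner_minus_left)
  qed
  \<comment> \<open>Both \<open>v\<close> and \<open>p\<close> lie in the adjoint, so
    \<open>v - p\<close> is orthogonal to each of them.\<close>
  have "inner (v - p) (v - p) = inner (r, s) v - inner (r, s) p"
    unfolding rs[symmetric] by (rule inner_diff_right)
  also have "\<dots> = 0"
    using rel[OF v] rel[OF \<open>p \<in> adjoint_operator T\<close>] by simp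
  finally have "v = p"
    by simp
  then show "v \<in> closure T"
    using p by simp
qed

section \<open>The tridiagonal operator\<close>

definition onb_partial_sum :: "(nat \<Rightarrow> 'a :: complex_hilbert) \<Rightarrow> nat \<Rightarrow> 'a \<Rightarrow> 'a" where
  "onb_partial_sum e N x = (\<Sum>n=1..N. cinner x (e n) *\<^sub>C e n)"

lemma norm_eq_cinner: "complex_of_real ((norm x)\<^sup>2) = cinner x (x :: 'a :: complex_hilbert)"
proof -
  have "Im (cinner x x) = 0"
    using arg_cong[OF cinner_commute[of x x], of Im] by simp
  then show ?thesis
    by (simp add: complex_eq_iff power2_norm_eq_inner inner_eq_Re_cinner del: of_real_power)
qed

context
  fixes e :: "nat \<Rightarrow> 'a :: complex_hilbert"
  assumes onb: "orthonormal_basis e"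
begin

lemma cinner_onb: "m \<ge> 1 \<Longrightarrow> n \<ge> 1 \<Longrightarrow> cinner (e m) (e n) = (if m = n then 1 else 0)"
  using onb by (simp add: orthonormal_basis_def)

lemma cinner_onb_partial_sum_left:
  "cinner (onb_partial_sum e N x) y = (\<Sum>n=1..N. cinner x (e n) * cinner (e n) y)"
  by (simp add: onb_partial_sum_def cinner_sum_left cinner_scaleC_left)

lemma onb_partial_sum_coeff:
  assumes "n \<ge> 1"
  shows "cinner (onb_partial_sum e N x) (e n) = (if n \<le> N then cinner x (e n) else 0)"
proof -
  have "cinner (onb_partial_sum e N x) (e n) =
      (\<Sum>k=1..N. if n = k then cinner x (e n) else 0)"
    unfolding cinner_onb_partial_sum_left using assms
    by (intro sum.cong) (auto simp: cinner_onb)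
  then show ?thesis
    using assms by simp
qed

text \<open>The partial sum shares its first \<open>N\<close> coefficients with \<open>x\<close>, so
  its squared norm is its inner product with \<open>x\<close>.\<close>

lemma norm_onb_partial_sum_le: "norm (onb_partial_sum e N x) \<le> norm x"
proof -
  let ?P = "onb_partial_sum e N x"
  have coeff: "cinner ?P (e n) = cinner x (e n)" if "n \<in> {1..N}" for n
    using that by (simp add: onb_partial_sum_coeff)
  have "cinner ?P ?P = (\<Sum>n=1..N. cinner x (e n) * cnj (cinner ?P (e n)))"
    unfolding cinner_onb_partial_sum_left[of N x ?P]
    by (intro sum.cong arg_cong2[where f = "(*)"] cinner_commute refl)
  also have "\<dots> = (\<Sum>n=1..N. cinner x (e n) * cnj (cinner x (e n)))"
    by (intro sum.cong) (simp_all add: coeff del: atLeastAtMost_iff)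
  also have "\<dots> = cinner ?P x"
    unfolding cinner_onb_partial_sum_left[of N x x]
    by (intro sum.cong arg_cong2[where f = "(*)"] cinner_commute[symmetric] refl)
  finally have "(norm ?P)\<^sup>2 = inner ?P x"
    by (simp add: power2_norm_eq_inner inner_eq_Re_cinner)
  also have "\<dots> \<le> norm ?P * norm x"
    by (rule norm_cauchy_schwarz)
  finally show ?thesis
    by (metis mult_le_cancel_left_pos norm_ge_zero order.order_iff_strict power2_eq_square)
qed

lemma bessel: "(\<Sum>n=1..N. (norm (cinner x (e n)))\<^sup>2) \<le> (norm x)\<^sup>2"
proof -
  let ?P = "onb_partial_sum e N x"
  have "complex_of_real (\<Sum>n=1..N. (norm (cinner x (e n)))\<^sup>2) = cinner ?P x"
    unfolding cinner_onb_partial_sum_left of_real_sum complex_norm_square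
    by (intro sum.cong arg_cong2[where f = "(*)"] cinner_commute[symmetric] refl)
  then have "(\<Sum>n=1..N. (norm (cinner x (e n)))\<^sup>2) = inner ?P x"
    by (metis Re_complex_of_real inner_eq_Re_cinner)
  also have "\<dots> \<le> norm ?P * norm x"
    by (rule norm_cauchy_schwarz)
  also have "\<dots> \<le> norm x * norm x"
    by (intro mult_right_mono norm_onb_partial_sum_le) auto
  finally show ?thesis
    by (simp add: power2_eq_square)
qed

lemma summable_onb_coeff: "summable (\<lambda>n. (norm (cinner x (e n)))\<^sup>2)"
proof -
  \<comment> \<open>Bessel's inequality concerns indices from 1 on, as \<open>e 0\<close> is
    arbitrary; the single term at 0 is added afterwards.\<close>
  have "summable (\<lambda>n. (norm (cinner x (e (Suc n))))\<^sup>2)"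
  proof (rule summableI_nonneg_bounded)
    show "(\<Sum>i<n. (norm (cinner x (e (Suc i))))\<^sup>2) \<le> (norm x)\<^sup>2" for n
      using bessel[where N = n and x = x]
      by (simp add: sum.atLeast1_atMost_eq)
  qed simp
  then show ?thesis
    using summable_Suc_iff[of "\<lambda>n. (norm (cinner x (e n)))\<^sup>2"] by simp
qed

lemma onb_partial_sum_eventually_id:
  assumes "x \<in> cspan (e ` {1..})"
  shows "\<exists>N. \<forall>M\<ge>N. onb_partial_sum e M x = x"
  using assms
proof (induction rule: complex_vector.span_induct_alt)
  case base
  show ?case by (simp add: onb_partial_sum_def)
next
  case (step c x y)
  then obtain k N where k: "x = e k" "k \<ge> 1" and N: "\<And>M. M \<ge> N \<Longrightarrow> onb_partial_sum e M y = y"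
    by auto
  have "onb_partial_sum e M (c *\<^sub>C x + y) = c *\<^sub>C x + y" if "M \<ge> max N k" for M
  proof -
    have "onb_partial_sum e M (c *\<^sub>C x + y) =
        (\<Sum>n=1..M. (c * cinner x (e n)) *\<^sub>C e n) + onb_partial_sum e M y"
      by (simp add: onb_partial_sum_def cinner_add_left cinner_scaleC_left scaleC_add_left sum.distrib)
    also have "(\<Sum>n=1..M. (c * cinner x (e n)) *\<^sub>C e n) = (\<Sum>n=1..M. if k = n then c *\<^sub>C e k else 0)"
      using k by (intro sum.cong) (auto simp: cinner_onb)
    also have "\<dots> = c *\<^sub>C x"
      using k that by simp
    finally show ?thesis
      using N that by simp
  qed
  then show ?case
    by blast
qed

text \<open>On the dense span the partial sums are eventually constant; the uniform norm bound
  carries convergence over to all \<open>x\<close>.\<close>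

lemma onb_partial_sum_tendsto: "(\<lambda>N. onb_partial_sum e N x) \<longlonglongrightarrow> x"
proof (rule LIMSEQ_I)
  fix r :: real assume "r > 0"
  have "x \<in> closure (cspan (e ` {1..}))"
    using onb by (simp add: orthonormal_basis_def)
  then obtain s where s: "s \<in> cspan (e ` {1..})" "dist s x < r / 2"
    using \<open>r > 0\<close> by (metis closure_approachable half_gt_zero)
  obtain N where N: "\<And>M. M \<ge> N \<Longrightarrow> onb_partial_sum e M s = s"
    using onb_partial_sum_eventually_id[OF s(1)] by blast
  have "norm (onb_partial_sum e M x - x) < r" if "M \<ge> N" for M
  proof -
    have "onb_partial_sum e M (x - s) = onb_partial_sum e M x - onb_partial_sum e M s"
      by (simp add: onb_partial_sum_def cinner_diff_left complex_vector.scale_left_diff_distrib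
          sum_subtractf)
    then have "onb_partial_sum e M x - x = onb_partial_sum e M (x - s) + (s - x)"
      using N[OF that] by simp
    then have "norm (onb_partial_sum e M x - x) \<le> norm (onb_partial_sum e M (x - s)) + norm (s - x)"
      by (simp only: norm_triangle_ineq)
    also have "\<dots> \<le> norm (x - s) + norm (s - x)"
      by (intro add_right_mono norm_onb_partial_sum_le)
    also have "\<dots> < r"
      using s(2) by (simp add: dist_norm norm_minus_commute)
    finally show ?thesis .
  qed
  then show "\<exists>N. \<forall>M\<ge>N. norm (onb_partial_sum e M x - x) < r"
    by blast
qed

lemma parseval: "(\<lambda>N. \<Sum>n=1..N. cinner x (e n) * cinner (e n) y) \<longlonglongrightarrow> cinner x y"
  unfolding cinner_onb_partial_sum_left[symmetric]
  by (intro tendsto_cinner onb_partial_sum_tendsto tendsto_const)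

lemma onb_ext:
  assumes "\<And>n. n \<ge> 1 \<Longrightarrow> cinner (e n) x = 0"
  shows "x = 0"
proof -
  have "(\<lambda>N. \<Sum>n=1..N. cinner x (e n) * cinner (e n) x) = (\<lambda>_. 0)"
    using assms by simp
  then have "cinner x x = 0"
    using parseval[of x x] by (simp add: LIMSEQ_const_iff)
  then show ?thesis
    by (simp flip: norm_eq_cinner)
qed

section \<open>The adjoint of the tridiagonal operator in coefficients\<close>

lemma tridiagonal_image_symmetric:
  assumes "m \<ge> 1" "n \<ge> 1"
  shows "cinner (tridiagonal_image a b e m) (e n) = cinner (e m) (tridiagonal_image a b e n)"
proof -
  have 1: "cinner (tridiagonal_image a b e m) (e n) =
      (if n = Suc m then a m else if n = m then b n else if Suc n = m then a n else 0)"
    if "m \<ge> 1" "n \<ge> 1" for m n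
  proof (cases "m = 1")
    case True
    then show ?thesis
      using that by (simp add: tridiagonal_image_def cinner_add_left cinner_scaleR_left cinner_onb)
  next
    case False
    then obtain k where "m = Suc k" "k \<ge> 1"
      using \<open>m \<ge> 1\<close> by (cases m) auto
    then show ?thesis
      using that by (simp add: tridiagonal_image_def cinner_add_left cinner_scaleR_left cinner_onb)
  qed
  have "cinner (e m) (tridiagonal_image a b e n) = cnj (cinner (tridiagonal_image a b e n) (e m))"
    by (rule cinner_commute)
  then show ?thesis
    using 1[OF assms] 1[OF assms(2,1)] by simp
qed

lemma tridiagonal_operator0_subset_adjoint:
  "tridiagonal_operator0 a b e \<subseteq> adjoint_operator (tridiagonal_operator0 a b e)"
proof -
  have "cinner (\<Sum>n=1..N. c n *\<^sub>C tridiagonal_image a b e n) (\<Sum>n=1..M. d n *\<^sub>C e n) =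
      cinner (\<Sum>n=1..N. c n *\<^sub>C e n) (\<Sum>n=1..M. d n *\<^sub>C tridiagonal_image a b e n)" for c d N M
    by (auto simp: cinner_sum_left cinner_sum_right cinner_scaleC_left cinner_scaleC_right
        tridiagonal_image_symmetric intro!: sum.cong)
  then show ?thesis
    by (auto simp: tridiagonal_operator0_def adjoint_operator_def)
qed

lemma onb_in_tridiagonal_operator0:
  assumes "n \<ge> 1"
  shows "(e n, tridiagonal_image a b e n) \<in> tridiagonal_operator0 a b e"
proof -
  have delta: "(\<Sum>k=1..n. (if k = n then 1 else 0) *\<^sub>C f k) = f n" for f :: "nat \<Rightarrow> 'a"
  proof -
    have "(if k = n then 1 else 0) *\<^sub>C f k = (if k = n then f k else 0)" for k
      by (cases "k = n") (simp_all add: scaleC_one)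
    then show ?thesis
      using assms by (simp only: sum.delta) simp
  qed
  have eq: "(e n, tridiagonal_image a b e n) =
      (\<Sum>k=1..n. (if k = n then 1 else 0) *\<^sub>C e k,
       \<Sum>k=1..n. (if k = n then 1 else 0) *\<^sub>C tridiagonal_image a b e k)"
    by (simp only: delta)
  show ?thesis
    unfolding tridiagonal_operator0_def
    by (intro CollectI exI[of _ "\<lambda>k. if k = n then 1 else 0"] exI[of _ n] conjI TrueI) (rule eq)
qed

text \<open>Testing against \<open>e n\<close> alone shows that the adjoint acts on coefficients by
  the same recursion.\<close>

lemma adjoint_tridiagonal_coeff:
  assumes "(y, z) \<in> adjoint_operator (tridiagonal_operator0 a b e)" "n \<ge> 1"
  shows "cinner (e n) z = a n * cinner (e (n + 1)) y + b n * cinner (e n) y +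
      (if n = 1 then 0 else a (n - 1) * cinner (e (n - 1)) y)"
proof -
  have "cinner (tridiagonal_image a b e n) y = cinner (e n) z"
    using assms onb_in_tridiagonal_operator0[OF assms(2), of a b]
    by (blast intro: adjoint_operatorD)
  then show ?thesis
    by (simp add: tridiagonal_image_def cinner_add_left cinner_scaleR_left split: if_splits)
qed

lemma adjoint_tridiagonal_coeff':
  assumes "(y, z) \<in> adjoint_operator (tridiagonal_operator0 a b e)" "n \<ge> 1"
  shows "cinner z (e n) = a n * cinner y (e (n + 1)) + b n * cinner y (e n) +
      (if n = 1 then 0 else a (n - 1) * cinner y (e (n - 1)))"
proof -
  have "cnj (cinner (e n) z) = cnj (a n * cinner (e (n + 1)) y + b n * cinner (e n) y +
      (if n = 1 then 0 else a (n - 1) * cinner (e (n - 1)) y))"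
    by (subst adjoint_tridiagonal_coeff[OF assms]) simp
  then show ?thesis
    unfolding cinner_commute[of z] cinner_commute[of y] by (simp split: if_splits)
qed

text \<open>By Parseval the defect of symmetry is a limit of Wronskians of coefficient sequences,
  and a null solution that is not square summable forces this limit to be 0.\<close>

lemma adjoint_tridiagonal_symmetric:
  fixes u :: "nat \<Rightarrow> real"
  assumes u: "\<And>n. n > M \<Longrightarrow> a n * u (n + 1) + b n * u n + a (n - 1) * u (n - 1) = 0"
      "\<not> summable (\<lambda>n. (u n)\<^sup>2)"
  shows "adjoint_operator (tridiagonal_operator0 a b e) \<subseteq>
    adjoint_operator (adjoint_operator (tridiagonal_operator0 a b e))"
proof -
  have symm: "cinner z y' = cinner y z'"
    if 1: "(y, z) \<in> adjoint_operator (tridiagonal_operator0 a b e)"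
      and 2: "(y', z') \<in> adjoint_operator (tridiagonal_operator0 a b e)" for y z y' z'
  proof -
    \<comment> \<open>\<open>p\<close> and \<open>f\<close> depend linearly on the vectors,
      \<open>q\<close> and \<open>g\<close> conjugate linearly; this matches the bilinear Wronskian
      with the sesquilinear inner product.\<close>
    define p q f g where "p n = cinner y (e n)" and "q n = cinner (e n) y'"
      and "f n = cinner z (e n)" and "g n = cinner (e n) z'" for n
    note defs = p_def q_def f_def g_def
    define W where "W n = complex_of_real (a n) * (p (n + 1) * q n - p n * q (n + 1))" for n
    have green: "(\<Sum>n=1..N. f n * q n - p n * g n) = W N" if "N \<ge> 1" for N
      using that
    proof (induction N rule: dec_induct)
      \<comment> \<open>There is no lower neighbour at index 1, hence no boundary term at the left
        end.\<close>
      case base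
      show ?case
        using adjoint_tridiagonal_coeff'[OF 1, of 1] adjoint_tridiagonal_coeff[OF 2, of 1]
        by (simp add: W_def defs algebra_simps)
    next
      case (step n)
      then have "f (Suc n) = a (Suc n) * p (Suc n + 1) + b (Suc n) * p (Suc n) + a n * p n"
        "g (Suc n) = a (Suc n) * q (Suc n + 1) + b (Suc n) * q (Suc n) + a n * q n"
        using adjoint_tridiagonal_coeff'[OF 1, of "Suc n"] adjoint_tridiagonal_coeff[OF 2, of "Suc n"]
        by (simp_all add: defs)
      then show ?case
        using step by (simp add: W_def algebra_simps)
    qed
    have "(\<lambda>N. (\<Sum>n=1..N. f n * q n) - (\<Sum>n=1..N. p n * g n)) \<longlonglongrightarrow> cinner z y' - cinner y z'"
      unfolding defs by (intro tendsto_diff parseval)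
    moreover have "\<forall>\<^sub>F N in sequentially. (\<Sum>n=1..N. f n * q n) - (\<Sum>n=1..N. p n * g n) = W N"
      using green by (auto simp: eventually_sequentially sum_subtractf intro!: exI[of _ 1])
    ultimately have lim: "W \<longlonglongrightarrow> cinner z y' - cinner y z'"
      by (rule Lim_transform_eventually)
    have q: "q n = cnj (cinner y' (e n))" and g: "g n = cnj (cinner z' (e n))" for n
      unfolding defs by (rule cinner_commute)+
    have "cinner z y' - cinner y z' = 0"
    proof (rule wronskian_tendsto_0)
      \<comment> \<open>The bound \<open>max M 1\<close> excludes \<open>n = 1\<close>, where the
        coefficient recursion has no \<open>a 0\<close> term.\<close>
      show "a n * complex_of_real (u (n + 1)) + b n * complex_of_real (u n) +
          a (n - 1) * complex_of_real (u (n - 1)) = 0" if "n > max M 1" for n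
        using arg_cong[OF u(1)[of n], of complex_of_real] that by simp
      show "\<not> summable (\<lambda>n. (norm (complex_of_real (u n)))\<^sup>2)"
        using u(2) by simp
      show "a n * p (n + 1) + b n * p n + a (n - 1) * p (n - 1) = f n" if "n > max M 1" for n
        using adjoint_tridiagonal_coeff'[OF 1, of n] that by (simp add: defs)
      show "a n * q (n + 1) + b n * q n + a (n - 1) * q (n - 1) = g n" if "n > max M 1" for n
        using adjoint_tridiagonal_coeff[OF 2, of n] that by (simp add: defs)
      show "summable (\<lambda>n. (norm (p n))\<^sup>2)" "summable (\<lambda>n. (norm (f n))\<^sup>2)"
        unfolding defs by (rule summable_onb_coeff)+
      show "summable (\<lambda>n. (norm (q n))\<^sup>2)" "summable (\<lambda>n. (norm (g n))\<^sup>2)"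
        unfolding q g complex_mod_cnj by (rule summable_onb_coeff)+
      show "(\<lambda>n. a n * (p (n + 1) * q n - p n * q (n + 1))) \<longlonglongrightarrow> cinner z y' - cinner y z'"
        using lim by (simp add: W_def[abs_def])
    qed
    then show ?thesis by simp
  qed
  show ?thesis
    by (rule subrelI, rule adjoint_operatorI) (rule symm)
qed

section \<open>The closure as a self-adjoint operator\<close>

lemma tridiagonal_operator0_add:
  assumes "(x, y) \<in> tridiagonal_operator0 a b e" "(x', y') \<in> tridiagonal_operator0 a b e"
  shows "(x + x', y + y') \<in> tridiagonal_operator0 a b e"
proof -
  obtain c N where 1: "x = (\<Sum>n=1..N. c n *\<^sub>C e n)" "y = (\<Sum>n=1..N. c n *\<^sub>C tridiagonal_image a b e n)"
    using assms(1) by (auto simp: tridiagonal_operator0_def)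
  obtain d M where 2: "x' = (\<Sum>n=1..M. d n *\<^sub>C e n)" "y' = (\<Sum>n=1..M. d n *\<^sub>C tridiagonal_image a b e n)"
    using assms(2) by (auto simp: tridiagonal_operator0_def)
  \<comment> \<open>Padding with zero coefficients gives both sums the same length.\<close>
  have extend: "(\<Sum>n=1..L. h n *\<^sub>C f n) = (\<Sum>n=1..max N M. (if n \<le> L then h n else 0) *\<^sub>C f n)"
    if "L \<le> max N M" for L h and f :: "nat \<Rightarrow> 'a"
    using that by (intro sum.mono_neutral_cong_left) auto
  let ?c = "\<lambda>n. (if n \<le> N then c n else 0) + (if n \<le> M then d n else 0)"
  have sums: "(\<Sum>n=1..N. c n *\<^sub>C f n) + (\<Sum>n=1..M. d n *\<^sub>C f n) = (\<Sum>n=1..max N M. ?c n *\<^sub>C f n)"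
    for f :: "nat \<Rightarrow> 'a"
    by (simp only: extend[of N c] extend[of M d] max.cobounded1 max.cobounded2 scaleC_add_left sum.distrib)
  show ?thesis
    unfolding tridiagonal_operator0_def 1 2 sums
    by (intro CollectI exI[of _ ?c] exI[of _ "max N M"] conjI refl TrueI)
qed

lemma tridiagonal_operator0_scale:
  assumes "(x, y) \<in> tridiagonal_operator0 a b e"
  shows "(r *\<^sub>C x, r *\<^sub>C y) \<in> tridiagonal_operator0 a b e"
proof -
  obtain c N where 1: "x = (\<Sum>n=1..N. c n *\<^sub>C e n)" "y = (\<Sum>n=1..N. c n *\<^sub>C tridiagonal_image a b e n)"
    using assms by (auto simp: tridiagonal_operator0_def)
  have sums: "r *\<^sub>C (\<Sum>n=1..N. c n *\<^sub>C f n) = (\<Sum>n=1..N. (r * c n) *\<^sub>C f n)" for f :: "nat \<Rightarrow> 'a"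
    by (simp add: complex_vector.scale_sum_right scaleC_scaleC)
  show ?thesis
    unfolding tridiagonal_operator0_def 1 sums
    by (intro CollectI exI[of _ "\<lambda>n. r * c n"] exI[of _ N] conjI refl TrueI)
qed

lemma tridiagonal_operator0_zero: "(0, 0) \<in> tridiagonal_operator0 a b e"
  unfolding tridiagonal_operator0_def by (intro CollectI exI[of _ "\<lambda>_. 0"] exI[of _ 0]) simp

lemma adjoint_tridiagonal_single_valued:
  assumes "(x, y) \<in> adjoint_operator (tridiagonal_operator0 a b e)"
    and "(x, z) \<in> adjoint_operator (tridiagonal_operator0 a b e)"
  shows "y = z"
proof -
  have "y - z = 0"
    by (rule onb_ext)
      (simp add: cinner_diff_right adjoint_tridiagonal_coeff[OF assms(1)]
        adjoint_tridiagonal_coeff[OF assms(2)])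
  then show ?thesis
    by simp
qed

text \<open>Symmetry of the adjoint identifies it with the closure, and passing to the closure does
  not change the adjoint, so the closure is its own adjoint.\<close>

lemma tridiagonal_operator_self_adjoint:
  fixes u :: "nat \<Rightarrow> real"
  assumes u: "\<And>n. n > M \<Longrightarrow> a n * u (n + 1) + b n * u n + a (n - 1) * u (n - 1) = 0"
      "\<not> summable (\<lambda>n. (u n)\<^sup>2)"
  shows "self_adjoint (tridiagonal_operator a b e)"
proof -
  let ?S = "tridiagonal_operator0 a b e" and ?T = "tridiagonal_operator a b e"
  have sub: "?T \<subseteq> adjoint_operator ?S"
    unfolding tridiagonal_operator_def
    by (rule closure_minimal[OF tridiagonal_operator0_subset_adjoint closed_adjoint_operator])
  moreover have "adjoint_operator ?S \<subseteq> ?T"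
    unfolding tridiagonal_operator_def
    by (rule adjoint_subset_closure_if_symmetric[OF tridiagonal_operator0_zero
        tridiagonal_operator0_add tridiagonal_operator0_scale tridiagonal_operator0_subset_adjoint
        adjoint_tridiagonal_symmetric[OF u]])
  ultimately have eq: "adjoint_operator ?S = ?T"
    by blast
  have adj: "adjoint_operator ?T = ?T"
    using eq adjoint_operator_closure[of ?S] by (simp add: tridiagonal_operator_def)
  have "linear_operator ?T"
    unfolding linear_operator_def
  \<comment> \<open>Single-valuedness and linearity are read off the adjoint, which is the same
    graph.\<close>
  proof (intro conjI allI impI)
    show "single_valued ?T"
      using adjoint_tridiagonal_single_valued unfolding eq[symmetric] by (intro single_valuedI)
    show "(0, 0) \<in> ?T"
      by (subst eq[symmetric]) (simp add: adjoint_operator_def)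
    show "(x + x', y + y') \<in> ?T" if "(x, y) \<in> ?T" "(x', y') \<in> ?T" for x y x' y'
      using that unfolding eq[symmetric]
      by (intro adjoint_operatorI) (simp add: cinner_add_right adjoint_operatorD)
    show "(c *\<^sub>C x, c *\<^sub>C y) \<in> ?T" if "(x, y) \<in> ?T" for c x y
      using that unfolding eq[symmetric]
      by (intro adjoint_operatorI) (simp add: cinner_scaleC_right adjoint_operatorD)
  qed
  moreover have "closure (Domain ?T) = UNIV"
  proof -
    have "x \<in> closure (Domain ?S)" for x
      unfolding closure_sequential
    proof (intro exI conjI allI)
      show "onb_partial_sum e N x \<in> Domain ?S" for N
        unfolding tridiagonal_operator0_def onb_partial_sum_def
        by (intro DomainI[where b = "\<Sum>n=1..N. cinner x (e n) *\<^sub>C tridiagonal_image a b e n"]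
            CollectI exI[of _ "\<lambda>n. cinner x (e n)"] exI[of _ N] conjI refl TrueI)
    qed (rule onb_partial_sum_tendsto)
    moreover have "Domain ?S \<subseteq> Domain ?T"
      unfolding tridiagonal_operator_def by (intro Domain_mono closure_subset)
    ultimately show ?thesis
      using closure_mono by blast
  qed
  ultimately show ?thesis
    using adj by (simp add: self_adjoint_def)
qed

end

text \<open>Forward solution of the recursion. It is applied to the sequences shifted by
  \<open>M\<close>, so index 0 here stands for \<open>M\<close>.\<close>

fun null_solution :: "(nat \<Rightarrow> real) \<Rightarrow> (nat \<Rightarrow> real) \<Rightarrow> nat \<Rightarrow> real" where
  "null_solution a b 0 = 0"
| "null_solution a b (Suc 0) = 1"
| "null_solution a b (Suc (Suc n)) =
    - (b (Suc n) * null_solution a b (Suc n) + a n * null_solution a b n) / a (Suc n)"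

theorem theorem4p7:
  fixes e :: "nat \<Rightarrow> 'a :: complex_hilbert"
    and a b :: "nat \<Rightarrow> real"
    and m :: nat
  assumes "orthonormal_basis e"
    and "\<And>n. n \<ge> 1 \<Longrightarrow> a n > 0"
    and "m \<ge> 1"
    and "\<exists>n0. \<forall>n\<ge>n0. G_tilde a b m n < 1 / 2 ^ m"
  shows "self_adjoint (tridiagonal_operator a b e)"
proof -
  obtain n0 where n0: "\<And>n. n \<ge> n0 \<Longrightarrow> G_tilde a b m n < 1 / 2 ^ m"
    using assms(4) by blast
  \<comment> \<open>Both the smallness hypothesis and the recursion for the path sums are then
    available from index \<open>M\<close> on.\<close>
  define M where "M = n0 + 2"
  have M: "M \<ge> 2" "M \<ge> n0"
    by (simp_all add: M_def)
  have b: "b (M + n) \<noteq> 0" if "n \<ge> 1" for n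
  proof -
    \<comment> \<open>The upward first step from \<open>M + n - 1\<close> has denominator
      \<open>b (M + n)\<close>.\<close>
    have "G_tilde a b m (M + n - 1) < 1 / 2 ^ m"
      using M that by (intro n0) auto
    then have "G_tilde a b m (M + n - 1) < top"
      by (rule order.strict_trans2) simp
    then show ?thesis
      using G_tilde_finite_imp_nonzero[where a = a and b = b and m = m and n = "M + n - 1"] assms(2) M that assms(3) by simp
  qed
  define v where "v = null_solution (\<lambda>n. a (M + n)) (\<lambda>n. b (M + n))"
  have v: "a (M + n) * v (n + 1) + b (M + n) * v n + a (M + (n - 1)) * v (n - 1) = 0"
    if "n \<ge> 1" for n
    using that assms(2)[of "M + n"] M
    by (cases n) (simp_all add: v_def field_simps)
  have "\<not> summable (\<lambda>n. (v n)\<^sup>2)"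
  proof (rule tridiagonal_null_solution_not_l2[OF b assms(3) _ _ _ v])
    fix n :: nat assume n: "n \<ge> 1"
    let ?g = "(nbr (\<lambda>n. (a (M + n) / b (M + (n + 1)))\<^sup>2)
      (\<lambda>n. (a (M + (n - 1)) / b (M + (n - 1)))\<^sup>2) ^^ m) (\<lambda>n. if n = 0 then 0 else 1) n"
    have "ennreal ?g \<le> G_tilde a b m (M + n)"
      using M n by (intro nbr_power_le_G_tilde b) auto
    also have "\<dots> \<le> 1 / 2 ^ m"
      using n0[of "M + n"] M by simp
    also have "\<dots> = ennreal (1 / 2 ^ m)"
      by (simp add: divide_ennreal[symmetric] ennreal_power[symmetric])
    finally show "?g \<le> 1 / 2 ^ m"
      by (simp add: ennreal_le_iff)
  qed (simp_all add: v_def)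
  \<comment> \<open>Shifted back by \<open>M\<close>; truncated subtraction makes the sequence 0 up
    to index \<open>M\<close>.\<close>
  then have "\<not> summable (\<lambda>n. (v (n - M))\<^sup>2)"
    using summable_iff_shift[of "\<lambda>n. (v (n - M))\<^sup>2" M] by simp
  moreover have "a n * v (n + 1 - M) + b n * v (n - M) + a (n - 1) * v (n - 1 - M) = 0"
    if "n > M" for n
    using v[of "n - M"] that by (simp add: Suc_diff_le)
  ultimately show ?thesis
    by (rule tridiagonal_operator_self_adjoint[OF assms(1), rotated])
qed

end
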